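(* For any fixed $r\in(0,\infty)$ and for every sequence of positive integers $s=s_n$ with $s_n/n\to0$ as $n\to\infty$, $$\min_{\widehat p\in\mathcal{G}_n[p]}\ \max_{\theta_n\in\Theta(n,s_n)}\rho(\theta_n,\widehat p)=r^{-1}\,s_n\log(n/s_n)\,(1+o(1))\quad\text{as }n\to\infty .$$
   Context: The observed past is $X_n\sim N(\theta_n,\sigma_p^2I_n)$ and the future is $Y_n\sim N(\theta_n,\sigma_f^2I_n)$, independent of $X_n$, with known variances and $r=\sigma_f^2/\sigma_p^2$. A predictive density estimate $\widehat p(\cdot|X_n)$ has Kullback-Leibler predictive risk $\rho(\theta_n,\widehat p)=\mathbb{E}_{\theta_n}\int p_{\theta_n}(y)\log\frac{p_{\theta_n}(y)}{\widehat p(y|X_n)}\,dy$, where $p_{\theta_n}$ is the $N(\theta_n,\sigma_f^2I_n)$ density and $\mathbb{E}_{\theta_n}$ is over $X_n\sim N(\theta_n,\sigma_p^2I_n)$. The class $\mathcal{G}_n[p]$ consists of all product Gaussian predictive density estimates, i.e. estimates $\widehat p(\cdot|X_n)$ equal to the density of $N(\widehat\theta_n(X_n),\sigma_f^2\widehat D_n(X_n))$, where the location estimate $\widehat\theta_n(X_n)\in\mathbb{R}^n$ and the $n\times n$ positive definite diagonal matrix $\widehat D_n(X_n)$ may depend on the observed data $X_n$. The sparse parameter space is $\Theta(n,s)=\{\theta\in\mathbb{R}^n:\sum_{i=1}^n\mathbf{1}[\theta_i\ne0]\le s\}$. *)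

theory Defs
  imports "HOL-Probability.Probability"
begin

text \<open>
  The dimension \<open>n\<close> tends to infinity, so vectors of \<open>\<real>\<^sup>n\<close> are functions on the index set
  \<open>{..<n}\<close> (extensional outside it), and \<open>lebesgue_Rn n\<close> is Borel-Lebesgue measure on them.
\<close>

abbreviation lebesgue_Rn :: "nat \<Rightarrow> (nat \<Rightarrow> real) measure" where
  "lebesgue_Rn n \<equiv> (\<Pi>\<^sub>M i\<in>{..<n}. lborel)"

text \<open>
  Density at \<open>y\<close> of the Gaussian law on \<open>\<real>\<^sup>n\<close> with mean \<open>\<mu>\<close> and diagonal covariance matrix
  with diagonal entries \<open>v i\<close>. The second argument of \<open>normal_density\<close> is a standard
  deviation, hence the square root.
\<close>

definition diag_gauss_density ::
    "nat \<Rightarrow> (nat \<Rightarrow> real) \<Rightarrow> (nat \<Rightarrow> real) \<Rightarrow> (nat \<Rightarrow> real) \<Rightarrow> real" where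
  "diag_gauss_density n \<mu> v y = (\<Prod>i<n. normal_density (\<mu> i) (sqrt (v i)) (y i))"

definition gauss_law :: "nat \<Rightarrow> (nat \<Rightarrow> real) \<Rightarrow> real \<Rightarrow> (nat \<Rightarrow> real) measure" where
  "gauss_law n \<theta> \<sigma> =
     density (lebesgue_Rn n) (\<lambda>x. ennreal (diag_gauss_density n \<theta> (\<lambda>_. \<sigma>\<^sup>2) x))"

text \<open>
  A predictive density estimate is a function \<open>p x y\<close> of the observation \<open>x\<close> and the future
  value \<open>y\<close>. In the Kullback-Leibler loss the integrand is integrable and the integral is
  nonnegative whenever \<open>p x\<close> is a nondegenerate Gaussian density. The expected loss may be
  infinite, so the risk takes values in the extended nonnegative reals.
\<close>

definition kl_loss ::
    "nat \<Rightarrow> real \<Rightarrow> (nat \<Rightarrow> real) \<Rightarrow> ((nat \<Rightarrow> real) \<Rightarrow> real) \<Rightarrow> real" where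
  "kl_loss n \<sigma>f \<theta> q =
     (\<integral>y. diag_gauss_density n \<theta> (\<lambda>_. \<sigma>f\<^sup>2) y *
           ln (diag_gauss_density n \<theta> (\<lambda>_. \<sigma>f\<^sup>2) y / q y) \<partial>lebesgue_Rn n)"

definition kl_risk ::
    "nat \<Rightarrow> real \<Rightarrow> real \<Rightarrow> (nat \<Rightarrow> real) \<Rightarrow>
     ((nat \<Rightarrow> real) \<Rightarrow> (nat \<Rightarrow> real) \<Rightarrow> real) \<Rightarrow> ennreal" where
  "kl_risk n \<sigma>p \<sigma>f \<theta> p = (\<integral>\<^sup>+x. ennreal (kl_loss n \<sigma>f \<theta> (p x)) \<partial>gauss_law n \<theta> \<sigma>p)"

text \<open>
  In the class of product Gaussian estimates, \<open>dhat x\<close> is the diagonal of the positive definite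
  diagonal matrix that scales the covariance. As usual for estimators, \<open>that\<close> and \<open>dhat\<close> are
  measurable functions of the whole observation.
\<close>

definition product_gaussian_estimates ::
    "nat \<Rightarrow> real \<Rightarrow> ((nat \<Rightarrow> real) \<Rightarrow> (nat \<Rightarrow> real) \<Rightarrow> real) set" where
  "product_gaussian_estimates n \<sigma>f =
     {p. \<exists>that \<in> measurable (lebesgue_Rn n) (lebesgue_Rn n).
         \<exists>dhat \<in> measurable (lebesgue_Rn n) (lebesgue_Rn n).
           (\<forall>x \<in> space (lebesgue_Rn n). \<forall>i<n. dhat x i > 0) \<and>
           p = (\<lambda>x. diag_gauss_density n (that x) (\<lambda>i. \<sigma>f\<^sup>2 * dhat x i))}"

definition sparse_vectors :: "nat \<Rightarrow> nat \<Rightarrow> (nat \<Rightarrow> real) set" where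
  "sparse_vectors n s =
     {\<theta> \<in> space (lebesgue_Rn n). (\<Sum>i<n. of_bool (\<theta> i \<noteq> 0)) \<le> s}"

definition gaussian_minimax_risk :: "nat \<Rightarrow> nat \<Rightarrow> real \<Rightarrow> real \<Rightarrow> ennreal" where
  "gaussian_minimax_risk n s \<sigma>p \<sigma>f =
     (INF p \<in> product_gaussian_estimates n \<sigma>f.
        SUP \<theta> \<in> sparse_vectors n s. kl_risk n \<sigma>p \<sigma>f \<theta> p)"

end

theory Submission
  imports Defs "HOL-Real_Asymp.Real_Asymp"
begin

text \<open>
  The loss splits into coordinate losses \<open>(ln d - 1 + 1/d + (\<theta>\<^sub>i - t)\<^sup>2 / (\<sigma>f\<^sup>2 d)) / 2\<close>.
  For \<open>d = 1\<close> this is a multiple of the squared error, so soft thresholding at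
  \<open>\<sigma>p \<surd>(2 log(n/s))\<close> gives the upper bound.

  For the lower bound, a coordinate that is \<open>\<mu>\<close> with posterior probability \<open>p\<close> and \<open>0\<close>
  otherwise costs at least \<open>ln (1 + p (1 - p) \<mu>\<^sup>2 / \<sigma>f\<^sup>2) / 2\<close>, whatever \<open>t\<close> and \<open>d\<close> are.
  This is close to \<open>p \<mu>\<^sup>2 / (2 \<sigma>f\<^sup>2)\<close> when \<open>p \<mu>\<^sup>2\<close> is small, so adapting the variance does not
  help. For \<open>\<mu>\<^sup>2 = 2 (1 - \<epsilon>) \<sigma>p\<^sup>2 log(n/s)\<close> the signal is undetectable: the posterior
  probability is small even under the signal, by a fractional moment of the likelihood ratio.
  Comparing supports of size \<open>s\<close> with those of size \<open>s - 1\<close> keeps the prior exactly sparse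
  (also for bounded \<open>s\<close>) while the posterior odds of each coordinate depend on that coordinate
  only.
\<close>

section \<open>Divergence and risk by coordinates\<close>

text \<open>
  Divergence of the law \<open>N(a, \<sigma>\<^sup>2)\<close> from the estimate \<open>N(t, d \<sigma>\<^sup>2)\<close>: \<open>d\<close> scales the variance, not the
  standard deviation.
\<close>

definition gauss_kl :: "real \<Rightarrow> real \<Rightarrow> real \<Rightarrow> real \<Rightarrow> real" where
  "gauss_kl \<sigma> a t d = (ln d - 1 + 1 / d + (a - t)\<^sup>2 / (\<sigma>\<^sup>2 * d)) / 2"

lemma gauss_kl_nonneg:
  assumes "d > 0"
  shows "gauss_kl \<sigma> a t d \<ge> 0"
proof -
  have "ln (1 / d) \<le> 1 / d - 1"
    using assms by (intro ln_le_minus_one) simp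
  then have "ln d - 1 + 1 / d \<ge> 0"
    using assms by (simp add: ln_div)
  then show ?thesis
    using assms by (simp add: gauss_kl_def)
qed

text \<open>Expanding around the mean leaves the variance, the squared bias and a cross term that is
  an odd central moment. The instance \<open>0\<close> of \<open>normal_moment_even\<close> is the
  total mass.\<close>

lemma normal_density_second_moment:
  fixes \<mu> \<sigma> t :: real
  assumes "\<sigma> > 0"
  shows "has_bochner_integral lborel (\<lambda>y. normal_density \<mu> \<sigma> y * (y - t)\<^sup>2) (\<sigma>\<^sup>2 + (\<mu> - t)\<^sup>2)"
proof -
  note m0 = normal_moment_even[OF assms, of \<mu> 0]
  note m1 = normal_moment_odd[OF assms, of \<mu> 0]
  note m2 = normal_moment_even[OF assms, of \<mu> 1]
  have "has_bochner_integral lborel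
      (\<lambda>y. normal_density \<mu> \<sigma> y * (y - \<mu>)\<^sup>2
        + (normal_density \<mu> \<sigma> y * (y - \<mu>)) * (2 * (\<mu> - t))
        + normal_density \<mu> \<sigma> y * (\<mu> - t)\<^sup>2)
      (\<sigma>\<^sup>2 + 0 * (2 * (\<mu> - t)) + 1 * (\<mu> - t)\<^sup>2)"
    using m0 m1 m2
    by (intro has_bochner_integral_add has_bochner_integral_mult_left) (simp_all add: fact_numeral)
  then show ?thesis
    by (simp add: power2_eq_square algebra_simps)
qed

text \<open>The normalising constants cancel up to \<open>ln d / 2\<close>, so the log ratio is
  quadratic in \<open>y\<close> and its mean needs only second moments.\<close>

lemma ln_normal_density_ratio:
  fixes \<sigma> d a t y :: real
  assumes "\<sigma> > 0" "d > 0"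
  shows "ln (normal_density a \<sigma> y / normal_density t (sqrt (\<sigma>\<^sup>2 * d)) y) =
    ln d / 2 - (y - a)\<^sup>2 / (2 * \<sigma>\<^sup>2) + (y - t)\<^sup>2 / (2 * \<sigma>\<^sup>2 * d)"
proof -
  have "ln (normal_density a \<sigma> y) = - ln (sqrt (2 * pi * \<sigma>\<^sup>2)) - (y - a)\<^sup>2 / (2 * \<sigma>\<^sup>2)"
    using assms by (simp add: normal_density_def ln_mult ln_div)
  moreover have "ln (normal_density t (sqrt (\<sigma>\<^sup>2 * d)) y) =
      - ln (sqrt (2 * pi * \<sigma>\<^sup>2)) - ln d / 2 - (y - t)\<^sup>2 / (2 * \<sigma>\<^sup>2 * d)"
    using assms
    by (simp add: normal_density_def ln_mult ln_div ln_sqrt real_sqrt_mult power_mult_distrib mult.assoc)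
  moreover have "ln (normal_density a \<sigma> y / normal_density t (sqrt (\<sigma>\<^sup>2 * d)) y) =
      ln (normal_density a \<sigma> y) - ln (normal_density t (sqrt (\<sigma>\<^sup>2 * d)) y)"
    using assms by (intro ln_divide_pos normal_density_pos) simp_all
  ultimately show ?thesis
    by simp
qed

lemma normal_kl_integral:
  fixes \<sigma> d a t :: real
  assumes "\<sigma> > 0" "d > 0"
  shows "has_bochner_integral lborel
    (\<lambda>y. normal_density a \<sigma> y * ln (normal_density a \<sigma> y / normal_density t (sqrt (\<sigma>\<^sup>2 * d)) y))
    (gauss_kl \<sigma> a t d)"
proof -
  note m = normal_density_second_moment[OF assms(1), of a a] normal_density_second_moment[OF assms(1), of a t]
  note m0 = normal_moment_even[OF assms(1), of a 0]
  have "has_bochner_integral lborel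
    (\<lambda>y. normal_density a \<sigma> y * (ln d / 2)
       - (normal_density a \<sigma> y * (y - a)\<^sup>2) * (1 / (2 * \<sigma>\<^sup>2))
       + (normal_density a \<sigma> y * (y - t)\<^sup>2) * (1 / (2 * \<sigma>\<^sup>2 * d)))
    (1 * (ln d / 2) - (\<sigma>\<^sup>2 + (a - a)\<^sup>2) * (1 / (2 * \<sigma>\<^sup>2)) + (\<sigma>\<^sup>2 + (a - t)\<^sup>2) * (1 / (2 * \<sigma>\<^sup>2 * d)))"
    using m0 m
    by (intro has_bochner_integral_add has_bochner_integral_diff has_bochner_integral_mult_left) auto
  moreover have "1 * (ln d / 2) - (\<sigma>\<^sup>2 + (a - a)\<^sup>2) * (1 / (2 * \<sigma>\<^sup>2))
      + (\<sigma>\<^sup>2 + (a - t)\<^sup>2) * (1 / (2 * \<sigma>\<^sup>2 * d)) = gauss_kl \<sigma> a t d"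
    using assms by (simp add: gauss_kl_def field_simps)
  ultimately show ?thesis
    unfolding ln_normal_density_ratio[OF assms] by (simp add: algebra_simps)
qed

text \<open>Absorbing \<open>h\<close> into factor \<open>i\<close> leaves a product of
  one-dimensional integrands, all others of which integrate to one.\<close>

lemma has_bochner_integral_product_marginal:
  fixes g :: "nat \<Rightarrow> real \<Rightarrow> real" and h :: "real \<Rightarrow> real"
  assumes "i < n"
    and g: "\<And>j. j < n \<Longrightarrow> has_bochner_integral lborel (g j) 1"
    and gh: "has_bochner_integral lborel (\<lambda>y. g i y * h y) I"
  shows "has_bochner_integral (lebesgue_Rn n) (\<lambda>y. (\<Prod>j<n. g j (y j)) * h (y i)) I"
proof -
  interpret product_sigma_finite "\<lambda>_. lborel :: real measure" ..
  define g' where "g' = (\<lambda>j. if j = i then (\<lambda>y. g i y * h y) else g j)"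
  have int: "has_bochner_integral lborel (g' j) (if j = i then I else 1)" if "j < n" for j
    using that g gh by (simp add: g'_def)
  have eq: "(\<Prod>j<n. g j (y j)) * h (y i) = (\<Prod>j<n. g' j (y j))" for y
  proof -
    have "(\<Prod>j\<in>{..<n} - {i}. g' j (y j)) = (\<Prod>j\<in>{..<n} - {i}. g j (y j))"
      by (intro prod.cong) (auto simp: g'_def)
    then show ?thesis
      using \<open>i < n\<close> by (simp add: prod.remove[of "{..<n}" i] g'_def)
  qed
  have "integrable (lebesgue_Rn n) (\<lambda>y. \<Prod>j<n. g' j (y j))"
    using int by (intro product_integrable_prod) (auto intro: integrable.intros)
  moreover have "(\<integral>y. (\<Prod>j<n. g' j (y j)) \<partial>lebesgue_Rn n) = (\<Prod>j<n. if j = i then I else 1)"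
  proof (subst product_integral_prod)
    show "(\<Prod>j<n. integral\<^sup>L lborel (g' j)) = (\<Prod>j<n. if j = i then I else 1)"
      using int by (intro prod.cong refl) (simp add: has_bochner_integral_integral_eq)
  qed (use int in \<open>auto intro: integrable.intros\<close>)
  ultimately show ?thesis
    unfolding eq has_bochner_integral_iff using \<open>i < n\<close> by simp
qed

lemma has_bochner_integral_gauss_marginal:
  fixes h :: "real \<Rightarrow> real"
  assumes "i < n" "\<sigma> > 0"
    and h: "has_bochner_integral lborel (\<lambda>y. normal_density (\<theta> i) \<sigma> y * h y) I"
  shows "has_bochner_integral (lebesgue_Rn n)
    (\<lambda>y. diag_gauss_density n \<theta> (\<lambda>_. \<sigma>\<^sup>2) y * h (y i)) I"
  unfolding diag_gauss_density_def
  using assms normal_moment_even[OF \<open>\<sigma> > 0\<close>, of _ 0]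
  by (intro has_bochner_integral_product_marginal) simp_all

lemma diag_gauss_density_nonneg: "diag_gauss_density n \<mu> v y \<ge> 0"
  by (simp add: diag_gauss_density_def prod_nonneg)

lemma nn_integral_gauss_marginal:
  fixes h :: "real \<Rightarrow> real"
  assumes "i < n" "\<sigma> > 0" and nonneg: "\<And>y. h y \<ge> 0"
    and h: "has_bochner_integral lborel (\<lambda>y. normal_density (\<theta> i) \<sigma> y * h y) I"
  shows "(\<integral>\<^sup>+y. ennreal (diag_gauss_density n \<theta> (\<lambda>_. \<sigma>\<^sup>2) y * h (y i)) \<partial>lebesgue_Rn n)
    = ennreal I"
  using has_bochner_integral_gauss_marginal[OF assms(1,2), where h = h and \<theta> = \<theta>, OF h] nonneg
  by (subst nn_integral_eq_integral) (auto simp: has_bochner_integral_iff diag_gauss_density_nonneg)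

text \<open>The logarithm of a ratio of products is a sum of one-coordinate terms, each of which
  integrates against its own marginal.\<close>

lemma kl_loss_diag_gauss:
  assumes "\<sigma> > 0" and d: "\<And>i. i < n \<Longrightarrow> d i > 0"
  shows "kl_loss n \<sigma> \<theta> (diag_gauss_density n t (\<lambda>i. \<sigma>\<^sup>2 * d i)) =
    (\<Sum>i<n. gauss_kl \<sigma> (\<theta> i) (t i) (d i))"
proof -
  let ?f = "diag_gauss_density n \<theta> (\<lambda>_. \<sigma>\<^sup>2)"
  let ?h = "\<lambda>i y. ln (normal_density (\<theta> i) \<sigma> y / normal_density (t i) (sqrt (\<sigma>\<^sup>2 * d i)) y)"
  have "?f y * ln (?f y / diag_gauss_density n t (\<lambda>i. \<sigma>\<^sup>2 * d i) y) =
      (\<Sum>i<n. ?f y * ?h i (y i))" for y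
  proof -
    have "ln (?f y / diag_gauss_density n t (\<lambda>i. \<sigma>\<^sup>2 * d i) y) = (\<Sum>i<n. ?h i (y i))"
      unfolding diag_gauss_density_def prod_dividef[symmetric]
      using assms by (subst ln_prod) (auto simp: less_imp_neq[OF normal_density_pos, symmetric])
    then show ?thesis
      by (simp add: sum_distrib_left)
  qed
  moreover have "has_bochner_integral (lebesgue_Rn n) (\<lambda>y. \<Sum>i<n. ?f y * ?h i (y i))
      (\<Sum>i<n. gauss_kl \<sigma> (\<theta> i) (t i) (d i))"
    using assms
    by (intro has_bochner_integral_sum has_bochner_integral_gauss_marginal normal_kl_integral) auto
  ultimately show ?thesis
    by (simp add: kl_loss_def has_bochner_integral_integral_eq)
qed

text \<open>\<open>t\<close> and \<open>d\<close> may use all of \<open>x\<close>, so the integral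
  stays over the whole space. The sampling density sits inside the integrand so that risks under
  different \<open>\<theta>\<close> can be compared at the same \<open>x\<close>.\<close>

definition coord_risk ::
  "nat \<Rightarrow> real \<Rightarrow> real \<Rightarrow> ((nat \<Rightarrow> real) \<Rightarrow> nat \<Rightarrow> real) \<Rightarrow> ((nat \<Rightarrow> real) \<Rightarrow> nat \<Rightarrow> real) \<Rightarrow>
    (nat \<Rightarrow> real) \<Rightarrow> nat \<Rightarrow> ennreal" where
  "coord_risk n \<sigma>p \<sigma>f t d \<theta> i =
    (\<integral>\<^sup>+x. ennreal (diag_gauss_density n \<theta> (\<lambda>_. \<sigma>p\<^sup>2) x * gauss_kl \<sigma>f (\<theta> i) (t x i) (d x i))
      \<partial>lebesgue_Rn n)"

lemma measurable_diag_gauss_density [measurable]: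
  "diag_gauss_density n \<mu> v \<in> borel_measurable (lebesgue_Rn n)"
  unfolding diag_gauss_density_def by measurable

lemma measurable_gauss_kl:
  assumes [measurable]: "t \<in> measurable (lebesgue_Rn n) (lebesgue_Rn n)"
      "d \<in> measurable (lebesgue_Rn n) (lebesgue_Rn n)" and "i < n"
  shows "(\<lambda>x. gauss_kl \<sigma> a (t x i) (d x i)) \<in> borel_measurable (lebesgue_Rn n)"
proof -
  have [measurable]: "(\<lambda>x. t x i) \<in> borel_measurable (lebesgue_Rn n)"
    "(\<lambda>x. d x i) \<in> borel_measurable (lebesgue_Rn n)"
    using \<open>i < n\<close> by (auto intro!: measurable_compose[OF assms(1)] measurable_compose[OF assms(2)])
  show ?thesis
    unfolding gauss_kl_def by measurable
qed

text \<open>Coordinate losses are nonnegative, so sum and integral commute even when some risks are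
  infinite.\<close>

lemma kl_risk_eq_sum_coord_risk:
  assumes "\<sigma>f > 0"
    and t: "t \<in> measurable (lebesgue_Rn n) (lebesgue_Rn n)"
    and d: "d \<in> measurable (lebesgue_Rn n) (lebesgue_Rn n)"
    and pos: "\<forall>x \<in> space (lebesgue_Rn n). \<forall>i<n. d x i > 0"
  shows "kl_risk n \<sigma>p \<sigma>f \<theta> (\<lambda>x. diag_gauss_density n (t x) (\<lambda>i. \<sigma>f\<^sup>2 * d x i)) =
    (\<Sum>i<n. coord_risk n \<sigma>p \<sigma>f t d \<theta> i)"
proof -
  let ?f = "diag_gauss_density n \<theta> (\<lambda>_. \<sigma>p\<^sup>2)"
  let ?k = "\<lambda>i x. gauss_kl \<sigma>f (\<theta> i) (t x i) (d x i)"
  note [measurable] = measurable_gauss_kl[OF t d]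
  have loss: "kl_loss n \<sigma>f \<theta> (diag_gauss_density n (t x) (\<lambda>i. \<sigma>f\<^sup>2 * d x i)) = (\<Sum>i<n. ?k i x)"
    if "x \<in> space (lebesgue_Rn n)" for x
    using that pos \<open>\<sigma>f > 0\<close> by (intro kl_loss_diag_gauss) auto
  have "kl_risk n \<sigma>p \<sigma>f \<theta> (\<lambda>x. diag_gauss_density n (t x) (\<lambda>i. \<sigma>f\<^sup>2 * d x i)) =
      (\<integral>\<^sup>+x. ennreal (\<Sum>i<n. ?k i x) \<partial>gauss_law n \<theta> \<sigma>p)"
    unfolding kl_risk_def using loss by (intro nn_integral_cong) (simp add: gauss_law_def)
  also have "\<dots> = (\<integral>\<^sup>+x. ennreal (?f x) * ennreal (\<Sum>i<n. ?k i x) \<partial>lebesgue_Rn n)"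
    unfolding gauss_law_def by (rule nn_integral_density) measurable
  also have "\<dots> = (\<integral>\<^sup>+x. (\<Sum>i<n. ennreal (?f x * ?k i x)) \<partial>lebesgue_Rn n)"
  proof (intro nn_integral_cong)
    fix x assume "x \<in> space (lebesgue_Rn n)"
    then have k: "?k i x \<ge> 0" if "i < n" for i
      using that pos by (simp add: gauss_kl_nonneg)
    then have "ennreal (?f x) * ennreal (\<Sum>i<n. ?k i x) = ennreal (\<Sum>i<n. ?f x * ?k i x)"
      by (subst sum_distrib_left[symmetric], intro ennreal_mult[symmetric])
        (auto intro!: sum_nonneg diag_gauss_density_nonneg)
    also have "\<dots> = (\<Sum>i<n. ennreal (?f x * ?k i x))"
      using k by (intro sum_ennreal[symmetric]) (simp add: diag_gauss_density_nonneg)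
    finally show "ennreal (?f x) * ennreal (\<Sum>i<n. ?k i x) = (\<Sum>i<n. ennreal (?f x * ?k i x))" .
  qed
  also have "\<dots> = (\<Sum>i<n. coord_risk n \<sigma>p \<sigma>f t d \<theta> i)"
    unfolding coord_risk_def by (intro nn_integral_sum) auto
  finally show ?thesis .
qed

section \<open>Soft thresholding\<close>

text \<open>Completing the square: an exponential tilt moves the mean by \<open>c\<close>. This
  evaluates both the thresholding error at zero and the likelihood ratio moments.\<close>

lemma normal_density_tilt:
  fixes \<mu> \<sigma> c x :: real
  assumes "\<sigma> > 0"
  shows "normal_density \<mu> \<sigma> x * exp (c * (x - \<mu>) / \<sigma>\<^sup>2) =
    exp (c\<^sup>2 / (2 * \<sigma>\<^sup>2)) * normal_density (\<mu> + c) \<sigma> x"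
proof -
  have "- (x - \<mu>)\<^sup>2 / (2 * \<sigma>\<^sup>2) + c * (x - \<mu>) / \<sigma>\<^sup>2 =
      c\<^sup>2 / (2 * \<sigma>\<^sup>2) + - (x - (\<mu> + c))\<^sup>2 / (2 * \<sigma>\<^sup>2)"
    using assms by (simp add: field_simps power2_eq_square)
  then have "exp (- (x - \<mu>)\<^sup>2 / (2 * \<sigma>\<^sup>2)) * exp (c * (x - \<mu>) / \<sigma>\<^sup>2) =
      exp (c\<^sup>2 / (2 * \<sigma>\<^sup>2)) * exp (- (x - (\<mu> + c))\<^sup>2 / (2 * \<sigma>\<^sup>2))"
    by (simp only: exp_add[symmetric])
  then show ?thesis
    by (simp add: normal_density_def)
qed

text \<open>A majorant of the loss that sees only coordinate \<open>i\<close> reduces the risk to a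
  one-dimensional integral.\<close>

lemma coord_risk_le:
  fixes h :: "real \<Rightarrow> real"
  assumes "i < n" "\<sigma>p > 0" and nonneg: "\<And>y. h y \<ge> 0"
    and h: "has_bochner_integral lborel (\<lambda>y. normal_density (\<theta> i) \<sigma>p y * h y) I"
    and le: "\<And>x. x \<in> space (lebesgue_Rn n) \<Longrightarrow> gauss_kl \<sigma>f (\<theta> i) (t x i) (d x i) \<le> h (x i)"
  shows "coord_risk n \<sigma>p \<sigma>f t d \<theta> i \<le> ennreal I"
  unfolding coord_risk_def nn_integral_gauss_marginal[OF assms(1-3), where \<theta> = \<theta>, OF h, symmetric]
  by (intro nn_integral_mono ennreal_leI mult_left_mono le diag_gauss_density_nonneg)

definition soft_threshold :: "real \<Rightarrow> real \<Rightarrow> real" where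
  "soft_threshold l x = (if x > l then x - l else if x < - l then x + l else 0)"

lemma measurable_soft_threshold [measurable]: "soft_threshold l \<in> borel_measurable borel"
  unfolding soft_threshold_def by measurable

lemma soft_threshold_diff:
  assumes "l \<ge> 0"
  shows "\<bar>soft_threshold l x - x\<bar> \<le> l"
  using assms by (auto simp: soft_threshold_def)

text \<open>A Chernoff-type majorant: beyond the threshold,
  \<open>exp (l * (\<bar>x\<bar> - l) / \<sigma>\<^sup>2)\<close> is at least one. Both tails are
  thus bounded by functions with closed-form Gaussian integrals.\<close>

lemma soft_threshold_zero_dominated:
  fixes l \<sigma> x :: real
  assumes "l \<ge> 0"
  shows "(soft_threshold l x)\<^sup>2 \<le>
    exp (- l\<^sup>2 / \<sigma>\<^sup>2) * (exp (l * x / \<sigma>\<^sup>2) * (x - l)\<^sup>2 + exp (- l * x / \<sigma>\<^sup>2) * (x + l)\<^sup>2)"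
proof -
  \<comment> \<open>Used with \<open>y = x\<close> for the upper tail and \<open>y = - x\<close> for
    the lower one.\<close>
  have exp_ge: "exp (- l\<^sup>2 / \<sigma>\<^sup>2) * exp (l * y / \<sigma>\<^sup>2) \<ge> 1" if "y \<ge> l" for y
  proof -
    have "l * l \<le> l * y"
      using that assms by (intro mult_left_mono)
    then have "- l\<^sup>2 / \<sigma>\<^sup>2 + l * y / \<sigma>\<^sup>2 \<ge> 0"
      by (simp add: power2_eq_square add_divide_distrib[symmetric] divide_right_mono)
    then show ?thesis
      by (simp add: exp_add[symmetric])
  qed
  define e1 where "e1 = exp (- l\<^sup>2 / \<sigma>\<^sup>2) * exp (l * x / \<sigma>\<^sup>2)"
  define e2 where "e2 = exp (- l\<^sup>2 / \<sigma>\<^sup>2) * exp (l * - x / \<sigma>\<^sup>2)"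
  have rhs: "exp (- l\<^sup>2 / \<sigma>\<^sup>2) * (exp (l * x / \<sigma>\<^sup>2) * (x - l)\<^sup>2 + exp (- l * x / \<sigma>\<^sup>2) * (x + l)\<^sup>2) =
      e1 * (x - l)\<^sup>2 + e2 * (x + l)\<^sup>2"
    by (simp add: e1_def e2_def distrib_left)
  have nonneg: "0 \<le> e1 * (x - l)\<^sup>2" "0 \<le> e2 * (x + l)\<^sup>2"
    by (simp_all add: e1_def e2_def)
  consider "x > l" | "x < - l" | "\<not> x > l" "\<not> x < - l"
    by blast
  then show ?thesis
  proof cases
    case 1
    then have "1 * (x - l)\<^sup>2 \<le> e1 * (x - l)\<^sup>2"
      unfolding e1_def by (intro mult_right_mono exp_ge) auto
    moreover have "soft_threshold l x = x - l"
      using 1 by (simp add: soft_threshold_def)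
    ultimately show ?thesis
      unfolding rhs using nonneg by simp
  next
    case 2
    then have "1 * (x + l)\<^sup>2 \<le> e2 * (x + l)\<^sup>2"
      unfolding e2_def by (intro mult_right_mono exp_ge) auto
    moreover have "soft_threshold l x = x + l"
      using 2 assms by (simp add: soft_threshold_def)
    ultimately show ?thesis
      unfolding rhs using nonneg by simp
  next
    case 3
    then have "soft_threshold l x = 0"
      by (simp add: soft_threshold_def)
    then show ?thesis
      unfolding rhs using nonneg by simp
  qed
qed

text \<open>After the tilt the mean is \<open>c\<close>, so the quadratic factor contributes exactly
  the variance.\<close>

lemma tilted_second_moment:
  fixes c \<sigma> :: real
  assumes "\<sigma> > 0"
  shows "has_bochner_integral lborel
    (\<lambda>y. normal_density 0 \<sigma> y * (exp (- c\<^sup>2 / \<sigma>\<^sup>2) * (exp (c * y / \<sigma>\<^sup>2) * (y - c)\<^sup>2)))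
    (\<sigma>\<^sup>2 * exp (- c\<^sup>2 / (2 * \<sigma>\<^sup>2)))"
proof -
  have eq: "normal_density 0 \<sigma> y * (exp (- c\<^sup>2 / \<sigma>\<^sup>2) * (exp (c * y / \<sigma>\<^sup>2) * (y - c)\<^sup>2)) =
      (normal_density c \<sigma> y * (y - c)\<^sup>2) * exp (- c\<^sup>2 / (2 * \<sigma>\<^sup>2))" for y
  proof -
    have "exp (- c\<^sup>2 / \<sigma>\<^sup>2) * exp (c\<^sup>2 / (2 * \<sigma>\<^sup>2)) = exp (- c\<^sup>2 / (2 * \<sigma>\<^sup>2))"
      using assms by (simp add: exp_add[symmetric] field_simps)
    then show ?thesis
      using arg_cong[OF normal_density_tilt[OF assms, of 0 y c],
          of "\<lambda>u. u * (exp (- c\<^sup>2 / \<sigma>\<^sup>2) * (y - c)\<^sup>2)"]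
      by (simp add: mult_ac)
  qed
  show ?thesis
    unfolding eq using has_bochner_integral_mult_left[of "exp (- c\<^sup>2 / (2 * \<sigma>\<^sup>2))",
        OF normal_density_second_moment[OF assms, of c c]]
    by simp
qed

text \<open>\<open>l\<close> is the threshold in units of \<open>\<sigma>p\<close>. At
  \<open>l\<^sup>2 = 2 * ln (n / s)\<close> the last factor is \<open>2 * s / n\<close>, so even
  \<open>n\<close> null coordinates cost only order \<open>s\<close>.\<close>

lemma soft_threshold_coord_risk_zero:
  assumes "i < n" "\<sigma>p > 0" "\<sigma>f > 0" "\<theta> i = 0" "l \<ge> 0"
    and t: "\<And>x. t x i = soft_threshold (\<sigma>p * l) (x i)" and d: "\<And>x. d x i = 1"
  shows "coord_risk n \<sigma>p \<sigma>f t d \<theta> i \<le> ennreal (\<sigma>p\<^sup>2 / (2 * \<sigma>f\<^sup>2) * (2 * exp (- l\<^sup>2 / 2)))"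
proof -
  define L where "L = \<sigma>p * l"
  have L: "L \<ge> 0" "L\<^sup>2 / (2 * \<sigma>p\<^sup>2) = l\<^sup>2 / 2"
    using assms by (simp_all add: L_def power_mult_distrib)
  define g where "g = (\<lambda>c y. exp (- c\<^sup>2 / \<sigma>p\<^sup>2) * (exp (c * y / \<sigma>p\<^sup>2) * (y - c)\<^sup>2))"
  show ?thesis
  proof (rule coord_risk_le[where h = "\<lambda>y. (g L y + g (- L) y) * (1 / (2 * \<sigma>f\<^sup>2))"])
    show "(g L y + g (- L) y) * (1 / (2 * \<sigma>f\<^sup>2)) \<ge> 0" for y
      by (simp add: g_def)
    have "has_bochner_integral lborel
        (\<lambda>y. (normal_density 0 \<sigma>p y * g L y + normal_density 0 \<sigma>p y * g (- L) y) * (1 / (2 * \<sigma>f\<^sup>2)))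
        ((\<sigma>p\<^sup>2 * exp (- L\<^sup>2 / (2 * \<sigma>p\<^sup>2)) + \<sigma>p\<^sup>2 * exp (- (- L)\<^sup>2 / (2 * \<sigma>p\<^sup>2))) * (1 / (2 * \<sigma>f\<^sup>2)))"
      unfolding g_def using assms
      by (intro has_bochner_integral_mult_left has_bochner_integral_add tilted_second_moment)
    then show "has_bochner_integral lborel
        (\<lambda>y. normal_density (\<theta> i) \<sigma>p y * ((g L y + g (- L) y) * (1 / (2 * \<sigma>f\<^sup>2))))
        (\<sigma>p\<^sup>2 / (2 * \<sigma>f\<^sup>2) * (2 * exp (- l\<^sup>2 / 2)))"
      using L(2) assms(4) by (simp add: algebra_simps add_divide_distrib)
    show "gauss_kl \<sigma>f (\<theta> i) (t x i) (d x i) \<le> (g L (x i) + g (- L) (x i)) * (1 / (2 * \<sigma>f\<^sup>2))" for x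
      using divide_right_mono[OF soft_threshold_zero_dominated[OF L(1), of "x i" \<sigma>p], of "2 * \<sigma>f\<^sup>2"]
      by (simp add: gauss_kl_def t d assms(4) g_def L_def[symmetric] algebra_simps add_divide_distrib)
  qed (use assms in auto)
qed

text \<open>Whatever \<open>\<theta> i\<close> is, the error is at most the noise plus
  \<open>\<sigma>p * l\<close>. The majorant is weighted so that its mean is exactly a multiple of
  \<open>(1 + l)\<^sup>2\<close>, with leading term \<open>l\<^sup>2\<close>.\<close>

lemma soft_threshold_coord_risk:
  assumes "i < n" "\<sigma>p > 0" "\<sigma>f > 0" "l \<ge> 0"
    and t: "\<And>x. t x i = soft_threshold (\<sigma>p * l) (x i)" and d: "\<And>x. d x i = 1"
  shows "coord_risk n \<sigma>p \<sigma>f t d \<theta> i \<le> ennreal (\<sigma>p\<^sup>2 / (2 * \<sigma>f\<^sup>2) * (1 + l)\<^sup>2)"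
proof (rule coord_risk_le[where
      h = "\<lambda>y. ((y - \<theta> i)\<^sup>2 * (1 + l) + \<sigma>p\<^sup>2 * (l + l\<^sup>2)) * (1 / (2 * \<sigma>f\<^sup>2))"])
  show "((y - \<theta> i)\<^sup>2 * (1 + l) + \<sigma>p\<^sup>2 * (l + l\<^sup>2)) * (1 / (2 * \<sigma>f\<^sup>2)) \<ge> 0" for y
    using assms by simp
  have "has_bochner_integral lborel
      (\<lambda>y. ((normal_density (\<theta> i) \<sigma>p y * (y - \<theta> i)\<^sup>2) * (1 + l)
        + normal_density (\<theta> i) \<sigma>p y * (\<sigma>p\<^sup>2 * (l + l\<^sup>2))) * (1 / (2 * \<sigma>f\<^sup>2)))
      (((\<sigma>p\<^sup>2 + (\<theta> i - \<theta> i)\<^sup>2) * (1 + l) + 1 * (\<sigma>p\<^sup>2 * (l + l\<^sup>2))) * (1 / (2 * \<sigma>f\<^sup>2)))"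
    using assms normal_moment_even[OF \<open>\<sigma>p > 0\<close>, of "\<theta> i" 0]
    by (intro has_bochner_integral_mult_left has_bochner_integral_add normal_density_second_moment)
      simp_all
  moreover have "((\<sigma>p\<^sup>2 + (\<theta> i - \<theta> i)\<^sup>2) * (1 + l) + 1 * (\<sigma>p\<^sup>2 * (l + l\<^sup>2))) * (1 / (2 * \<sigma>f\<^sup>2)) =
      \<sigma>p\<^sup>2 / (2 * \<sigma>f\<^sup>2) * (1 + l)\<^sup>2"
    using assms by (simp add: field_simps power2_eq_square)
  ultimately show "has_bochner_integral lborel
      (\<lambda>y. normal_density (\<theta> i) \<sigma>p y *
        (((y - \<theta> i)\<^sup>2 * (1 + l) + \<sigma>p\<^sup>2 * (l + l\<^sup>2)) * (1 / (2 * \<sigma>f\<^sup>2))))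
      (\<sigma>p\<^sup>2 / (2 * \<sigma>f\<^sup>2) * (1 + l)\<^sup>2)"
    by (simp add: algebra_simps)
  show "gauss_kl \<sigma>f (\<theta> i) (t x i) (d x i) \<le>
      ((x i - \<theta> i)\<^sup>2 * (1 + l) + \<sigma>p\<^sup>2 * (l + l\<^sup>2)) * (1 / (2 * \<sigma>f\<^sup>2))" for x
  proof -
    define z where "z = \<bar>x i - \<theta> i\<bar>"
    have "\<bar>\<theta> i - t x i\<bar> \<le> z + \<sigma>p * l"
      using soft_threshold_diff[of "\<sigma>p * l" "x i"] assms by (simp add: t z_def)
    then have "(\<theta> i - t x i)\<^sup>2 \<le> (z + \<sigma>p * l)\<^sup>2"
      using abs_le_square_iff by fastforce
    \<comment> \<open>AM-GM for the cross term \<open>2 \<sigma>p l z\<close>\<close>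
    also have "\<dots> \<le> (z + \<sigma>p * l)\<^sup>2 + l * (z - \<sigma>p)\<^sup>2"
      using assms by simp
    also have "\<dots> = z\<^sup>2 * (1 + l) + \<sigma>p\<^sup>2 * (l + l\<^sup>2)"
      by (simp add: power2_eq_square algebra_simps)
    finally have "(\<theta> i - t x i)\<^sup>2 \<le> (x i - \<theta> i)\<^sup>2 * (1 + l) + \<sigma>p\<^sup>2 * (l + l\<^sup>2)"
      by (simp add: z_def)
    from divide_right_mono[OF this, of "2 * \<sigma>f\<^sup>2"] show ?thesis
      by (simp add: gauss_kl_def d)
  qed
qed (use assms in auto)

lemma gaussian_minimax_risk_upper:
  assumes "\<sigma>p > 0" "\<sigma>f > 0" "l \<ge> 0"
  shows "gaussian_minimax_risk n s \<sigma>p \<sigma>f \<le>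
    ennreal (\<sigma>p\<^sup>2 / (2 * \<sigma>f\<^sup>2) * (real s * (1 + l)\<^sup>2 + 2 * real n * exp (- l\<^sup>2 / 2)))"
proof -
  \<comment> \<open>Restricting to the index set makes the values extensional, as points of
    \<open>lebesgue_Rn n\<close> must be.\<close>
  define t where "t = (\<lambda>x. \<lambda>i\<in>{..<n}. soft_threshold (\<sigma>p * l) (x i))"
  define d :: "(nat \<Rightarrow> real) \<Rightarrow> nat \<Rightarrow> real" where "d = (\<lambda>x. \<lambda>i\<in>{..<n}. 1)"
  let ?C = "\<sigma>p\<^sup>2 / (2 * \<sigma>f\<^sup>2)"
  let ?p = "\<lambda>x. diag_gauss_density n (t x) (\<lambda>i. \<sigma>f\<^sup>2 * d x i)"
  have t: "t \<in> measurable (lebesgue_Rn n) (lebesgue_Rn n)"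
    unfolding t_def by measurable
  have d: "d \<in> measurable (lebesgue_Rn n) (lebesgue_Rn n)"
    unfolding d_def by measurable
  have pos: "\<forall>x \<in> space (lebesgue_Rn n). \<forall>i<n. d x i > 0"
    by (simp add: d_def)
  have p: "?p \<in> product_gaussian_estimates n \<sigma>f"
    using t d pos by (auto simp: product_gaussian_estimates_def)
  have "kl_risk n \<sigma>p \<sigma>f \<theta> ?p \<le> ennreal (?C * (real s * (1 + l)\<^sup>2 + 2 * real n * exp (- l\<^sup>2 / 2)))"
    if "\<theta> \<in> sparse_vectors n s" for \<theta>
  proof -
    define u where "u = ?C * (1 + l)\<^sup>2"
    define v where "v = ?C * (2 * exp (- l\<^sup>2 / 2))"
    have uv: "u \<ge> 0" "v \<ge> 0"
      by (simp_all add: u_def v_def)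
    \<comment> \<open>The null price \<open>v\<close> is charged to nonzero coordinates as well,
      which makes the sum a count times \<open>u\<close> plus \<open>n\<close> times
      \<open>v\<close>.\<close>
    let ?b = "\<lambda>i. of_bool (\<theta> i \<noteq> 0) * u + v"
    have b: "coord_risk n \<sigma>p \<sigma>f t d \<theta> i \<le> ennreal (?b i)" if "i < n" for i
    proof (cases "\<theta> i = 0")
      case True
      then show ?thesis
        using soft_threshold_coord_risk_zero[OF that assms(1,2), of \<theta> l t d] that assms
        by (simp add: t_def d_def v_def)
    next
      case False
      have "coord_risk n \<sigma>p \<sigma>f t d \<theta> i \<le> ennreal u"
        unfolding u_def using that assms by (intro soft_threshold_coord_risk) (auto simp: t_def d_def)
      also have "\<dots> \<le> ennreal (?b i)"
        using False uv by (intro ennreal_leI) simp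
      finally show ?thesis .
    qed
    have "real (\<Sum>i<n. of_bool (\<theta> i \<noteq> 0)) \<le> real s"
      using that unfolding sparse_vectors_def by (intro of_nat_mono) simp
    then have sparse: "(\<Sum>i<n. of_bool (\<theta> i \<noteq> 0)) \<le> real s"
      by simp
    have "kl_risk n \<sigma>p \<sigma>f \<theta> ?p = (\<Sum>i<n. coord_risk n \<sigma>p \<sigma>f t d \<theta> i)"
      using assms t d pos by (intro kl_risk_eq_sum_coord_risk)
    also have "\<dots> \<le> (\<Sum>i<n. ennreal (?b i))"
      using b by (intro sum_mono) auto
    also have "\<dots> = ennreal (\<Sum>i<n. ?b i)"
      using uv by (intro sum_ennreal) simp
    also have "(\<Sum>i<n. ?b i) = (\<Sum>i<n. of_bool (\<theta> i \<noteq> 0)) * u + real n * v"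
      by (simp only: sum.distrib sum_distrib_right[symmetric]) simp
    also have "ennreal \<dots> \<le> ennreal (real s * u + real n * v)"
      using sparse uv by (intro ennreal_leI add_right_mono mult_right_mono) auto
    finally show ?thesis
      by (simp add: u_def v_def algebra_simps)
  qed
  then show ?thesis
    unfolding gaussian_minimax_risk_def by (intro INF_lower2[OF p] SUP_least)
qed

section \<open>The two-point problem in one coordinate\<close>

text \<open>\<open>\<alpha>\<close> and \<open>\<beta>\<close> are unnormalised posterior weights of
  \<open>\<mu>\<close> and \<open>0\<close>. The best \<open>t\<close> is the posterior mean and the
  best \<open>d\<close> is \<open>1 + v\<close>, which leaves \<open>w * ln (1 + v) / 2\<close>.
  This is weakened to an expression in \<open>\<alpha>\<close> and the odds
  \<open>\<alpha> / \<beta>\<close>.\<close>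

lemma gauss_kl_two_point:
  fixes \<alpha> \<beta> \<mu> \<sigma> t d :: real
  assumes "\<alpha> > 0" "\<beta> > 0" "\<sigma> > 0" "d > 0"
  defines "K \<equiv> \<mu>\<^sup>2 / \<sigma>\<^sup>2"
  shows "\<alpha> * (K / 2) / (1 + \<alpha> / \<beta> * (1 + K)) \<le> \<alpha> * gauss_kl \<sigma> \<mu> t d + \<beta> * gauss_kl \<sigma> 0 t d"
proof -
  define w where "w = \<alpha> + \<beta>"
  define v where "v = \<alpha> * \<beta> * K / w\<^sup>2"
  have K: "K \<ge> 0" and w: "w > 0"
    using assms by (simp_all add: K_def w_def)
  have v: "v \<ge> 0"
    using assms K by (simp add: v_def)
  have "\<alpha> * \<beta> * \<mu>\<^sup>2 / w \<le> \<alpha> * (\<mu> - t)\<^sup>2 + \<beta> * t\<^sup>2"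
  proof -
    \<comment> \<open>The square vanishes at the posterior mean
      \<open>t = \<alpha> * \<mu> / w\<close>.\<close>
    have "(\<alpha> * (\<mu> - t)\<^sup>2 + \<beta> * t\<^sup>2) * w = (w * t - \<alpha> * \<mu>)\<^sup>2 + \<alpha> * \<beta> * \<mu>\<^sup>2"
      by (simp add: w_def power2_eq_square algebra_simps)
    then show ?thesis
      using w by (simp add: pos_divide_le_eq)
  qed
  then have "\<alpha> * \<beta> * \<mu>\<^sup>2 / w / (\<sigma>\<^sup>2 * d) \<le> (\<alpha> * (\<mu> - t)\<^sup>2 + \<beta> * t\<^sup>2) / (\<sigma>\<^sup>2 * d)"
    using assms by (intro divide_right_mono) auto
  moreover have "\<alpha> * \<beta> * \<mu>\<^sup>2 / w / (\<sigma>\<^sup>2 * d) = w * v / d"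
    using w by (simp add: v_def K_def power2_eq_square mult_ac)
  moreover have "2 * (\<alpha> * gauss_kl \<sigma> \<mu> t d + \<beta> * gauss_kl \<sigma> 0 t d) =
      w * (ln d - 1 + 1 / d) + (\<alpha> * (\<mu> - t)\<^sup>2 + \<beta> * t\<^sup>2) / (\<sigma>\<^sup>2 * d)"
    by (simp add: gauss_kl_def w_def algebra_simps add_divide_distrib diff_divide_distrib)
  ultimately have "w * (ln d - 1 + 1 / d) + w * v / d \<le>
      2 * (\<alpha> * gauss_kl \<sigma> \<mu> t d + \<beta> * gauss_kl \<sigma> 0 t d)"
    by linarith
  then have "w * (ln d - 1 + (1 + v) / d) \<le> 2 * (\<alpha> * gauss_kl \<sigma> \<mu> t d + \<beta> * gauss_kl \<sigma> 0 t d)"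
    by (simp add: algebra_simps add_divide_distrib)
  moreover have "w * (v / (1 + v)) \<le> w * (ln d - 1 + (1 + v) / d)"
  proof -
    \<comment> \<open>The first logarithm bound eliminates \<open>d\<close>, with equality at
      \<open>d = 1 + v\<close>; the second, at \<open>1 / (1 + v)\<close>, turns
      \<open>ln (1 + v)\<close> into a rational lower bound.\<close>
    have "ln ((1 + v) / d) \<le> (1 + v) / d - 1"
      using v assms by (intro ln_le_minus_one) simp
    moreover have "ln ((1 + v) / d) = ln (1 + v) - ln d"
      using v assms by (intro ln_divide_pos) auto
    moreover have "ln (1 / (1 + v)) \<le> 1 / (1 + v) - 1"
      using v by (intro ln_le_minus_one) simp
    moreover have "ln (1 / (1 + v)) = - ln (1 + v)"
      using v by (simp add: ln_div)
    moreover have "1 / (1 + v) - 1 = - (v / (1 + v))"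
      using v by (simp add: field_simps)
    ultimately have "v / (1 + v) \<le> ln d - 1 + (1 + v) / d"
      by linarith
    then show ?thesis
      using w by (intro mult_left_mono) auto
  qed
  moreover have "\<alpha> * K / (1 + \<alpha> / \<beta> * (1 + K)) \<le> w * (v / (1 + v))"
  proof -
    have "\<alpha> * \<beta> * K \<le> \<alpha> * w * K"
      using assms(1) K by (intro mult_right_mono mult_left_mono) (auto simp: w_def)
    then have "w\<^sup>2 + \<alpha> * \<beta> * K \<le> w * (w + \<alpha> * K)"
      by (simp add: power2_eq_square algebra_simps)
    moreover have pos: "w\<^sup>2 + \<alpha> * \<beta> * K > 0" "w + \<alpha> * K > 0"
      using w K assms by (auto intro!: add_pos_nonneg)
    ultimately have "(\<alpha> * \<beta> * K * w) / (w * (w + \<alpha> * K)) \<le> (\<alpha> * \<beta> * K * w) / (w\<^sup>2 + \<alpha> * \<beta> * K)"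
      using w K assms by (intro divide_left_mono) auto
    moreover have "(\<alpha> * \<beta> * K * w) / (w * (w + \<alpha> * K)) = \<alpha> * K / (1 + \<alpha> / \<beta> * (1 + K))"
    proof -
      have "\<beta> * (1 + \<alpha> / \<beta> * (1 + K)) = w + \<alpha> * K"
        using assms by (simp add: w_def field_simps)
      then have "\<alpha> * K / (1 + \<alpha> / \<beta> * (1 + K)) = \<beta> * (\<alpha> * K) / (w + \<alpha> * K)"
        using assms by (metis less_irrefl mult_divide_mult_cancel_left)
      then show ?thesis
        using w by (simp add: mult_ac)
    qed
    moreover have "(\<alpha> * \<beta> * K * w) / (w\<^sup>2 + \<alpha> * \<beta> * K) = w * (v / (1 + v))"
    proof -
      have "w\<^sup>2 * (1 + v) = w\<^sup>2 + \<alpha> * \<beta> * K" "w\<^sup>2 * v = \<alpha> * \<beta> * K"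
        using w by (simp_all add: v_def distrib_left)
      then have "v / (1 + v) = (\<alpha> * \<beta> * K) / (w\<^sup>2 + \<alpha> * \<beta> * K)"
        using w by (metis less_irrefl mult_divide_mult_cancel_left zero_less_power)
      then show ?thesis
        by simp
    qed
    ultimately show ?thesis
      by simp
  qed
  ultimately have "\<alpha> * K / (1 + \<alpha> / \<beta> * (1 + K)) \<le>
      2 * (\<alpha> * gauss_kl \<sigma> \<mu> t d + \<beta> * gauss_kl \<sigma> 0 t d)"
    by (meson order_trans)
  then have "\<alpha> * K / (1 + \<alpha> / \<beta> * (1 + K)) / 2 \<le>
      \<alpha> * gauss_kl \<sigma> \<mu> t d + \<beta> * gauss_kl \<sigma> 0 t d"
    by (subst pos_divide_le_eq) (simp_all only: mult.commute zero_less_numeral)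
  then show ?thesis
    by (simp only: times_divide_eq_right divide_divide_eq_left mult.commute)
qed

text \<open>The deficit \<open>y / (1 + y)\<close> is at most the minimum of \<open>1\<close> and
  \<open>y\<close>, hence at most \<open>y powr \<tau>\<close>. A small \<open>\<tau>\<close> is
  essential later: near the critical \<open>\<mu>\<close>, the first moment of the likelihood ratio
  under the signal is too large.\<close>

lemma inverse_one_plus_ge_powr:
  fixes y \<tau> :: real
  assumes "y > 0" "0 < \<tau>" "\<tau> \<le> 1"
  shows "1 - y powr \<tau> \<le> 1 / (1 + y)"
proof (cases "y \<le> 1")
  case True
  then have "y powr 1 \<le> y powr \<tau>"
    using assms by (intro powr_mono') auto
  moreover have "1 - y \<le> 1 / (1 + y)"
    using assms by (simp add: field_simps)
  ultimately show ?thesis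
    using assms by simp
next
  case False
  then have "1 \<le> y powr \<tau>"
    using assms by (simp add: ge_one_powr_ge_zero)
  moreover have "0 \<le> 1 / (1 + y)"
    using assms by simp
  ultimately show ?thesis
    by linarith
qed

text \<open>The error term is added on the right instead of subtracted on the left, so that the
  inequality can be integrated in \<open>ennreal\<close>.\<close>

lemma gauss_kl_two_point_powr:
  fixes \<alpha> \<beta> \<mu> \<sigma> t d \<tau> :: real
  assumes "\<alpha> > 0" "\<beta> > 0" "\<sigma> > 0" "d > 0" "0 < \<tau>" "\<tau> \<le> 1"
  defines "K \<equiv> \<mu>\<^sup>2 / \<sigma>\<^sup>2"
  shows "\<alpha> * (K / 2) \<le> \<alpha> * gauss_kl \<sigma> \<mu> t d + \<beta> * gauss_kl \<sigma> 0 t d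
    + \<alpha> * (K / 2 * (\<alpha> / \<beta> * (1 + K)) powr \<tau>)"
proof -
  have K: "K \<ge> 0"
    by (simp add: K_def)
  have "0 < \<alpha> / \<beta> * (1 + K)"
    using assms(1,2) K by (intro mult_pos_pos divide_pos_pos) auto
  then have "\<alpha> * (K / 2) * (1 - (\<alpha> / \<beta> * (1 + K)) powr \<tau>) \<le> \<alpha> * (K / 2) * (1 / (1 + \<alpha> / \<beta> * (1 + K)))"
    using assms(1,5,6) K by (intro mult_left_mono inverse_one_plus_ge_powr) auto
  also have "\<dots> \<le> \<alpha> * gauss_kl \<sigma> \<mu> t d + \<beta> * gauss_kl \<sigma> 0 t d"
    using gauss_kl_two_point[OF assms(1-4), of \<mu> t] by (simp add: K_def)
  finally show ?thesis
    by (simp add: right_diff_distrib mult.assoc)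
qed

text \<open>The two laws differ in coordinate \<open>i\<close> only, so their likelihood ratio
  depends on \<open>x i\<close> alone.\<close>

lemma diag_gauss_density_shift:
  assumes "\<sigma> > 0" "i < n" "\<theta> i = 0"
  shows "diag_gauss_density n (\<theta>(i := \<mu>)) (\<lambda>_. \<sigma>\<^sup>2) x =
    diag_gauss_density n \<theta> (\<lambda>_. \<sigma>\<^sup>2) x * exp (\<mu> * x i / \<sigma>\<^sup>2 - \<mu>\<^sup>2 / (2 * \<sigma>\<^sup>2))"
proof -
  have "exp (\<mu> * x i / \<sigma>\<^sup>2 - \<mu>\<^sup>2 / (2 * \<sigma>\<^sup>2)) * normal_density 0 \<sigma> (x i) = normal_density \<mu> \<sigma> (x i)"
    using normal_density_tilt[OF assms(1), of 0 "x i" \<mu>] by (simp add: exp_diff field_simps)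
  then show ?thesis
    using assms by (simp add: diag_gauss_density_def prod.remove[of "{..<n}" i] mult_ac)
qed

lemma diag_gauss_density_pos: "\<sigma> > 0 \<Longrightarrow> diag_gauss_density n \<theta> (\<lambda>_. \<sigma>\<^sup>2) x > 0"
  by (auto simp: diag_gauss_density_def intro!: prod_pos normal_density_pos)

lemma likelihood_ratio_powr_moment:
  fixes \<mu> \<sigma> \<kappa> \<tau> :: real
  assumes "\<sigma> > 0" "\<kappa> > 0"
  shows "has_bochner_integral lborel
    (\<lambda>y. normal_density \<mu> \<sigma> y * (\<kappa> * exp (\<mu> * y / \<sigma>\<^sup>2 - \<mu>\<^sup>2 / (2 * \<sigma>\<^sup>2))) powr \<tau>)
    (\<kappa> powr \<tau> * exp ((\<tau> + \<tau>\<^sup>2) * \<mu>\<^sup>2 / (2 * \<sigma>\<^sup>2)))"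
proof -
  have "normal_density \<mu> \<sigma> y * (\<kappa> * exp (\<mu> * y / \<sigma>\<^sup>2 - \<mu>\<^sup>2 / (2 * \<sigma>\<^sup>2))) powr \<tau> =
      normal_density (\<mu> + \<tau> * \<mu>) \<sigma> y * (\<kappa> powr \<tau> * exp ((\<tau> + \<tau>\<^sup>2) * \<mu>\<^sup>2 / (2 * \<sigma>\<^sup>2)))" for y
  proof -
    \<comment> \<open>Recentring at \<open>\<mu>\<close>, the mean of the law in use, prepares a
      tilt by \<open>\<tau> * \<mu>\<close>. The leftover \<open>\<tau>\<close> term and the
      \<open>\<tau>\<^sup>2\<close> term of the tilt form the final exponent.\<close>
    have "\<tau> * (\<mu> * y / \<sigma>\<^sup>2 - \<mu>\<^sup>2 / (2 * \<sigma>\<^sup>2)) =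
        \<tau> * \<mu> * (y - \<mu>) / \<sigma>\<^sup>2 + \<tau> * \<mu>\<^sup>2 / (2 * \<sigma>\<^sup>2)"
      using assms by (simp add: field_simps power2_eq_square)
    then have "(\<kappa> * exp (\<mu> * y / \<sigma>\<^sup>2 - \<mu>\<^sup>2 / (2 * \<sigma>\<^sup>2))) powr \<tau> =
        \<kappa> powr \<tau> * (exp (\<tau> * \<mu> * (y - \<mu>) / \<sigma>\<^sup>2) * exp (\<tau> * \<mu>\<^sup>2 / (2 * \<sigma>\<^sup>2)))"
      using assms by (simp add: powr_mult exp_powr_real mult.commute[of _ \<tau>] exp_add)
    then have "normal_density \<mu> \<sigma> y * (\<kappa> * exp (\<mu> * y / \<sigma>\<^sup>2 - \<mu>\<^sup>2 / (2 * \<sigma>\<^sup>2))) powr \<tau> =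
        (normal_density \<mu> \<sigma> y * exp (\<tau> * \<mu> * (y - \<mu>) / \<sigma>\<^sup>2)) *
          (\<kappa> powr \<tau> * exp (\<tau> * \<mu>\<^sup>2 / (2 * \<sigma>\<^sup>2)))"
      by (simp add: mult_ac)
    also have "\<dots> = normal_density (\<mu> + \<tau> * \<mu>) \<sigma> y *
        (\<kappa> powr \<tau> * (exp ((\<tau> * \<mu>)\<^sup>2 / (2 * \<sigma>\<^sup>2)) * exp (\<tau> * \<mu>\<^sup>2 / (2 * \<sigma>\<^sup>2))))"
      by (subst normal_density_tilt[OF assms(1)]) (simp add: mult_ac)
    also have "exp ((\<tau> * \<mu>)\<^sup>2 / (2 * \<sigma>\<^sup>2)) * exp (\<tau> * \<mu>\<^sup>2 / (2 * \<sigma>\<^sup>2)) =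
        exp ((\<tau> + \<tau>\<^sup>2) * \<mu>\<^sup>2 / (2 * \<sigma>\<^sup>2))"
      by (simp add: exp_add[symmetric] add_divide_distrib[symmetric] power_mult_distrib algebra_simps)
    finally show ?thesis .
  qed
  moreover have "has_bochner_integral lborel (normal_density (\<mu> + \<tau> * \<mu>) \<sigma>) 1"
    using normal_moment_even[OF assms(1), of _ 0] by simp
  ultimately show ?thesis
    using has_bochner_integral_mult_left[of "\<kappa> powr \<tau> * exp ((\<tau> + \<tau>\<^sup>2) * \<mu>\<^sup>2 / (2 * \<sigma>\<^sup>2))"
        lborel "normal_density (\<mu> + \<tau> * \<mu>) \<sigma>" 1]
    by simp
qed

text \<open>At fixed \<open>x\<close> an arbitrary estimate is just a pair of numbers, so the
  two-point bound applies with prior weight times likelihood as \<open>\<alpha>\<close> and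
  \<open>\<beta>\<close>; integrating over \<open>x\<close> gives the risks.\<close>

lemma coord_risk_two_point:
  fixes a b \<mu> \<sigma>p \<sigma>f \<tau> :: real
  assumes "a > 0" "b > 0" "\<sigma>p > 0" "\<sigma>f > 0" "0 < \<tau>" "\<tau> \<le> 1" "i < n" "\<theta> i = 0"
    and t: "t \<in> measurable (lebesgue_Rn n) (lebesgue_Rn n)"
    and d: "d \<in> measurable (lebesgue_Rn n) (lebesgue_Rn n)"
    and pos: "\<forall>x \<in> space (lebesgue_Rn n). \<forall>i<n. d x i > 0"
  defines "K \<equiv> \<mu>\<^sup>2 / \<sigma>f\<^sup>2"
  shows "ennreal (a * (K / 2)) \<le>
    ennreal a * coord_risk n \<sigma>p \<sigma>f t d (\<theta>(i := \<mu>)) i + ennreal b * coord_risk n \<sigma>p \<sigma>f t d \<theta> i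
    + ennreal (a * (K / 2) * ((a / b * (1 + K)) powr \<tau> * exp ((\<tau> + \<tau>\<^sup>2) * \<mu>\<^sup>2 / (2 * \<sigma>p\<^sup>2))))"
proof -
  let ?f = "diag_gauss_density n \<theta> (\<lambda>_. \<sigma>p\<^sup>2)"
  let ?g = "diag_gauss_density n (\<theta>(i := \<mu>)) (\<lambda>_. \<sigma>p\<^sup>2)"
  let ?A = "\<lambda>x. gauss_kl \<sigma>f 0 (t x i) (d x i)"
  let ?B = "\<lambda>x. gauss_kl \<sigma>f \<mu> (t x i) (d x i)"
  let ?L = "\<lambda>y. exp (\<mu> * y / \<sigma>p\<^sup>2 - \<mu>\<^sup>2 / (2 * \<sigma>p\<^sup>2))"
  let ?h = "\<lambda>y. (a / b * (1 + K) * ?L y) powr \<tau>"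
  let ?I = "(a / b * (1 + K)) powr \<tau> * exp ((\<tau> + \<tau>\<^sup>2) * \<mu>\<^sup>2 / (2 * \<sigma>p\<^sup>2))"
  have K: "K \<ge> 0"
    by (simp add: K_def)
  note [measurable] = measurable_gauss_kl[OF t d \<open>i < n\<close>]
  have [measurable]: "(\<lambda>x. x i) \<in> borel_measurable (lebesgue_Rn n)"
    using \<open>i < n\<close> by simp
  have pointwise: "ennreal (a * (K / 2)) * ennreal (?g x) \<le>
      ennreal a * ennreal (?g x * ?B x) + ennreal b * ennreal (?f x * ?A x)
      + ennreal (a * (K / 2)) * ennreal (?g x * ?h (x i))"
    if x: "x \<in> space (lebesgue_Rn n)" for x
  proof -
    have f: "?f x > 0" and g: "?g x > 0"
      using assms by (auto intro: diag_gauss_density_pos)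
    have "?g x = ?f x * ?L (x i)"
      using assms by (intro diag_gauss_density_shift)
    \<comment> \<open>In the posterior odds the other coordinates cancel.\<close>
    then have ratio: "(a * ?g x) / (b * ?f x) * (1 + K) = a / b * (1 + K) * ?L (x i)"
      using f assms by (simp add: field_simps)
    have d: "d x i > 0"
      using x pos assms by auto
    have "(a * ?g x) * (K / 2) \<le> (a * ?g x) * ?B x + (b * ?f x) * ?A x
        + (a * ?g x) * (K / 2 * ((a * ?g x) / (b * ?f x) * (1 + K)) powr \<tau>)"
      unfolding K_def using assms f g d by (intro gauss_kl_two_point_powr) auto
    then have "(a * (K / 2)) * ?g x \<le> a * (?g x * ?B x) + b * (?f x * ?A x)
        + (a * (K / 2)) * (?g x * ?h (x i))"
      unfolding ratio by (simp add: mult_ac)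
    moreover have "?A x \<ge> 0" "?B x \<ge> 0"
      using d by (auto intro: gauss_kl_nonneg)
    ultimately show ?thesis
      using assms(1,2) f g K
      by (simp add: ennreal_mult[symmetric] ennreal_plus[symmetric] del: ennreal_plus)
  qed
  have g1: "(\<integral>\<^sup>+x. ennreal (?g x) \<partial>lebesgue_Rn n) = 1"
    using nn_integral_gauss_marginal[OF \<open>i < n\<close> \<open>\<sigma>p > 0\<close>, of "\<lambda>_. 1" "\<theta>(i := \<mu>)" 1]
      normal_moment_even[OF \<open>\<sigma>p > 0\<close>, of _ 0] by simp
  have gh: "(\<integral>\<^sup>+x. ennreal (?g x * ?h (x i)) \<partial>lebesgue_Rn n) = ennreal ?I"
    using assms K likelihood_ratio_powr_moment[of \<sigma>p "a / b * (1 + K)" \<mu> \<tau>]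
    by (intro nn_integral_gauss_marginal) (auto simp: add_pos_nonneg)
  have "ennreal (a * (K / 2)) = (\<integral>\<^sup>+x. ennreal (a * (K / 2)) * ennreal (?g x) \<partial>lebesgue_Rn n)"
    by (simp add: nn_integral_cmult g1)
  also have "\<dots> \<le> (\<integral>\<^sup>+x. ennreal a * ennreal (?g x * ?B x) + ennreal b * ennreal (?f x * ?A x)
      + ennreal (a * (K / 2)) * ennreal (?g x * ?h (x i)) \<partial>lebesgue_Rn n)"
    by (intro nn_integral_mono pointwise)
  also have "\<dots> = ennreal a * (\<integral>\<^sup>+x. ennreal (?g x * ?B x) \<partial>lebesgue_Rn n)
      + ennreal b * (\<integral>\<^sup>+x. ennreal (?f x * ?A x) \<partial>lebesgue_Rn n)
      + ennreal (a * (K / 2)) * ennreal ?I"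
    unfolding gh[symmetric] by (simp add: nn_integral_add nn_integral_cmult)
  also have "ennreal (a * (K / 2)) * ennreal ?I = ennreal (a * (K / 2) * ?I)"
    using \<open>a > 0\<close> K by (intro ennreal_mult[symmetric]) auto
  finally show ?thesis
    using \<open>\<theta> i = 0\<close> by (simp add: coord_risk_def fun_upd_def)
qed

section \<open>The minimax lower bound\<close>

definition spike :: "nat \<Rightarrow> real \<Rightarrow> nat set \<Rightarrow> nat \<Rightarrow> real" where
  "spike n \<mu> S = (\<lambda>i\<in>{..<n}. if i \<in> S then \<mu> else 0)"

lemma spike_sparse:
  assumes "S \<subseteq> {..<n}" "card S \<le> s"
  shows "spike n \<mu> S \<in> sparse_vectors n s"
proof -
  have "(\<Sum>i<n. of_bool (spike n \<mu> S i \<noteq> 0)) \<le> (\<Sum>i<n. of_bool (i \<in> S) :: nat)"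
    by (intro sum_mono) (simp add: spike_def)
  also have "\<dots> \<le> s"
    using assms by (simp add: Int_absorb1)
  finally show ?thesis
    unfolding sparse_vectors_def by (simp add: spike_def space_PiM del: sum_of_bool_eq)
qed

lemma spike_insert:
  assumes "i < n" "i \<in> S"
  shows "spike n \<mu> S = (spike n \<mu> (S - {i}))(i := \<mu>)"
  using assms by (auto simp: spike_def fun_eq_iff)

text \<open>The map from \<open>(S, i)\<close> to \<open>(S - {i}, i)\<close> is injective when
  \<open>i \<in> S\<close>. Pairs outside its image are added for free by nonnegativity.\<close>

lemma sum_remove_element_le:
  fixes f :: "nat set \<Rightarrow> nat \<Rightarrow> ennreal"
  assumes "s > 0"
  shows "(\<Sum>S | S \<subseteq> {..<n} \<and> card S = s. \<Sum>i\<in>S. f (S - {i}) i) \<le>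
    (\<Sum>T | T \<subseteq> {..<n} \<and> card T = s - 1. \<Sum>i<n. f T i)"
proof -
  let ?A = "\<lambda>k. {S. S \<subseteq> {..<n} \<and> card S = k}"
  have fin: "finite (?A k)" for k
    by (rule finite_subset[of _ "Pow {..<n}"]) auto
  have finS: "finite S" if "S \<in> ?A s" for S
    using that finite_subset by blast
  let ?r = "\<lambda>(S, i). (S - {i}, i)"
  have inj: "inj_on ?r (Sigma (?A s) (\<lambda>S. S))"
    by (auto simp: inj_on_def)
  have "(\<Sum>S\<in>?A s. \<Sum>i\<in>S. f (S - {i}) i) = (\<Sum>(S, i)\<in>Sigma (?A s) (\<lambda>S. S). f (S - {i}) i)"
    using fin finS by (intro sum.Sigma ballI)
  also have "\<dots> = (\<Sum>(T, i)\<in>?r ` Sigma (?A s) (\<lambda>S. S). f T i)"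
    using inj by (subst sum.reindex) (simp_all add: case_prod_unfold)
  also have "\<dots> \<le> (\<Sum>(T, i)\<in>?A (s - 1) \<times> {..<n}. f T i)"
  proof (intro sum_mono2)
    show "finite (?A (s - 1) \<times> {..<n})"
      using fin by simp
    show "?r ` Sigma (?A s) (\<lambda>S. S) \<subseteq> ?A (s - 1) \<times> {..<n}"
      by (auto simp: card_Diff_singleton)
  qed simp
  also have "\<dots> = (\<Sum>T\<in>?A (s - 1). \<Sum>i<n. f T i)"
    by (intro sum.cartesian_product[symmetric])
  finally show ?thesis .
qed

text \<open>
  The least favourable prior has total weight \<open>w\<close> on the spikes with \<open>s\<close> nonzero coordinates and
  \<open>1 - w\<close> on those with \<open>s - 1\<close>, uniformly within each level. Every pair \<open>i \<in> S\<close> contributes a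
  two-point problem in coordinate \<open>i\<close> between \<open>S\<close> and \<open>S - {i}\<close>, and the remaining
  coordinate risks are discarded.
\<close>

lemma kl_risk_lower:
  fixes \<mu> \<sigma>p \<sigma>f \<tau> w M :: real
  assumes "\<sigma>p > 0" "\<sigma>f > 0" "0 < \<tau>" "\<tau> \<le> 1" "0 < w" "w < 1" "0 < s" "s \<le> n"
    and t: "t \<in> measurable (lebesgue_Rn n) (lebesgue_Rn n)"
    and d: "d \<in> measurable (lebesgue_Rn n) (lebesgue_Rn n)"
    and pos: "\<forall>x \<in> space (lebesgue_Rn n). \<forall>i<n. d x i > 0"
    and M: "\<And>\<theta>. \<theta> \<in> sparse_vectors n s \<Longrightarrow> (\<Sum>i<n. coord_risk n \<sigma>p \<sigma>f t d \<theta> i) \<le> ennreal M"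
    and "M \<ge> 0"
  defines "K \<equiv> \<mu>\<^sup>2 / \<sigma>f\<^sup>2"
  shows "real s * w * (K / 2) *
    (1 - (w / (1 - w) * (real s / real (n - s + 1)) * (1 + K)) powr \<tau>
      * exp ((\<tau> + \<tau>\<^sup>2) * \<mu>\<^sup>2 / (2 * \<sigma>p\<^sup>2))) \<le> M"
proof -
  let ?A = "\<lambda>k. {S. S \<subseteq> {..<n} \<and> card S = k}"
  let ?R = "\<lambda>S i. coord_risk n \<sigma>p \<sigma>f t d (spike n \<mu> S) i"
  define N where "N = real (n choose s)"
  define N' where "N' = real (n choose (s - 1))"
  \<comment> \<open>Prior mass of a single support at level \<open>s\<close>, and below at level
    \<open>s - 1\<close>; for \<open>s = 1\<close> the lower level is the zero vector alone.\<close>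
  define a where "a = w / N"
  define b where "b = (1 - w) / N'"
  have N: "N > 0" "N' > 0"
    using assms by (simp_all add: N_def N'_def)
  have K: "K \<ge> 0"
    by (simp add: K_def)
  have ab: "a > 0" "b > 0"
    using N assms by (simp_all add: a_def b_def)
  have card: "card (?A k) = n choose k" for k
    using n_subsets[of "{..<n}" k] by simp
  \<comment> \<open>Both sides count pairs of a set of size \<open>s\<close> and one of its
    elements. This fixes the prior odds \<open>a / b\<close>.\<close>
  have "s * (n choose s) = (n - s + 1) * (n choose (s - 1))"
    using binomial_absorb_comp[of n "s - 1"] binomial_absorption[of "s - 1" n] \<open>0 < s\<close> \<open>s \<le> n\<close>
    by (simp add: Suc_diff_le)
  then have "real s * N = real (n - s + 1) * N'"
    unfolding N_def N'_def by (metis of_nat_mult)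
  then have "N' / N = real s / real (n - s + 1)"
    using N by (simp add: field_simps)
  moreover have "a / b = w / (1 - w) * (N' / N)"
    by (simp add: a_def b_def)
  ultimately have a_div_b: "a / b = w / (1 - w) * (real s / real (n - s + 1))"
    by simp
  define e where "e = (a / b * (1 + K)) powr \<tau> * exp ((\<tau> + \<tau>\<^sup>2) * \<mu>\<^sup>2 / (2 * \<sigma>p\<^sup>2))"
  have e: "e \<ge> 0"
    by (simp add: e_def)
  have total: "(\<Sum>S\<in>?A k. \<Sum>i<n. ?R S i) \<le> ennreal (real (n choose k) * M)" if "k \<le> s" for k
  proof -
    have "(\<Sum>S\<in>?A k. \<Sum>i<n. ?R S i) \<le> (\<Sum>S\<in>?A k. ennreal M)"
      using that by (intro sum_mono M spike_sparse) auto
    then show ?thesis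
      using \<open>M \<ge> 0\<close> by (simp add: card ennreal_mult ennreal_of_nat_eq_real_of_nat)
  qed
  have const: "(\<Sum>S\<in>?A s. \<Sum>i\<in>S. ennreal c) = ennreal (N * real s * c)" if "c \<ge> 0" for c
    using that by (simp add: card N_def ennreal_mult ennreal_of_nat_eq_real_of_nat mult.assoc)
  have "ennreal (N * real s * (a * (K / 2))) = (\<Sum>S\<in>?A s. \<Sum>i\<in>S. ennreal (a * (K / 2)))"
    using ab K by (intro const[symmetric]) simp
  also have "\<dots> \<le> (\<Sum>S\<in>?A s. \<Sum>i\<in>S. ennreal a * ?R S i + ennreal b * ?R (S - {i}) i
      + ennreal (a * (K / 2) * e))"
  proof (intro sum_mono)
    fix S i assume "S \<in> ?A s" "i \<in> S"
    then have i: "i < n" "i \<in> S"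
      by auto
    show "ennreal (a * (K / 2)) \<le> ennreal a * ?R S i + ennreal b * ?R (S - {i}) i
        + ennreal (a * (K / 2) * e)"
      using coord_risk_two_point[OF ab assms(1-4) i(1) _ t d pos, of "spike n \<mu> (S - {i})" \<mu>] i
      unfolding spike_insert[OF i] e_def K_def by (simp add: spike_def)
  qed
  also have "\<dots> = ennreal a * (\<Sum>S\<in>?A s. \<Sum>i\<in>S. ?R S i)
      + ennreal b * (\<Sum>S\<in>?A s. \<Sum>i\<in>S. ?R (S - {i}) i) + ennreal (N * real s * (a * (K / 2) * e))"
    using ab K e by (subst const[symmetric]) (simp_all add: sum.distrib sum_distrib_left)
  \<comment> \<open>The levels cost at most \<open>w * M\<close> and \<open>(1 - w) * M\<close>, so
    together just \<open>M\<close>: no risk is counted twice.\<close>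
  also have "\<dots> \<le> ennreal a * ennreal (N * M) + ennreal b * ennreal (N' * M)
      + ennreal (N * real s * (a * (K / 2) * e))"
  proof (intro add_mono mult_left_mono order.refl)
    have "(\<Sum>S\<in>?A s. \<Sum>i\<in>S. ?R S i) \<le> (\<Sum>S\<in>?A s. \<Sum>i<n. ?R S i)"
      by (intro sum_mono sum_mono2) auto
    then show "(\<Sum>S\<in>?A s. \<Sum>i\<in>S. ?R S i) \<le> ennreal (N * M)"
      using total[of s] by (simp add: N_def)
    show "(\<Sum>S\<in>?A s. \<Sum>i\<in>S. ?R (S - {i}) i) \<le> ennreal (N' * M)"
      using sum_remove_element_le[OF \<open>0 < s\<close>, of ?R n] total[of "s - 1"] by (simp add: N'_def)
  qed auto
  also have "\<dots> = ennreal (a * (N * M) + b * (N' * M) + N * real s * (a * (K / 2) * e))"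
    using ab N \<open>M \<ge> 0\<close> K e by (simp add: ennreal_mult)
  finally have "N * real s * (a * (K / 2)) \<le>
      a * (N * M) + b * (N' * M) + N * real s * (a * (K / 2) * e)"
    using ab N \<open>M \<ge> 0\<close> K e by (subst (asm) ennreal_le_iff) auto
  moreover have "a * N = w" "b * N' = 1 - w"
    using N by (simp_all add: a_def b_def)
  moreover have "a * (N * M) + b * (N' * M) = (a * N) * M + (b * N') * M"
      "N * real s * (a * (K / 2)) = real s * (a * N) * (K / 2)"
      "N * real s * (a * (K / 2) * e) = real s * (a * N) * (K / 2) * e"
    by simp_all
  ultimately have "real s * w * (K / 2) \<le> w * M + (1 - w) * M + real s * w * (K / 2) * e"
    by (simp only:)
  then have "real s * w * (K / 2) * (1 - e) \<le> M"
    by (simp only: right_diff_distrib) (simp add: algebra_simps)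
  then show ?thesis
    unfolding e_def a_div_b .
qed

text \<open>Only a finite supremum needs the averaging bound. If the left side is negative,
  \<open>ennreal\<close> truncates it to zero.\<close>

lemma gaussian_minimax_risk_lower:
  fixes \<mu> \<sigma>p \<sigma>f \<tau> w :: real
  assumes "\<sigma>p > 0" "\<sigma>f > 0" "0 < \<tau>" "\<tau> \<le> 1" "0 < w" "w < 1" "0 < s" "s \<le> n"
  defines "K \<equiv> \<mu>\<^sup>2 / \<sigma>f\<^sup>2"
  shows "ennreal (real s * w * (K / 2) *
    (1 - (w / (1 - w) * (real s / real (n - s + 1)) * (1 + K)) powr \<tau>
      * exp ((\<tau> + \<tau>\<^sup>2) * \<mu>\<^sup>2 / (2 * \<sigma>p\<^sup>2)))) \<le> gaussian_minimax_risk n s \<sigma>p \<sigma>f"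
  unfolding gaussian_minimax_risk_def
proof (intro INF_greatest)
  fix p assume "p \<in> product_gaussian_estimates n \<sigma>f"
  then obtain t d where td: "t \<in> measurable (lebesgue_Rn n) (lebesgue_Rn n)"
      "d \<in> measurable (lebesgue_Rn n) (lebesgue_Rn n)"
      "\<forall>x \<in> space (lebesgue_Rn n). \<forall>i<n. d x i > 0"
    and p: "p = (\<lambda>x. diag_gauss_density n (t x) (\<lambda>i. \<sigma>f\<^sup>2 * d x i))"
    unfolding product_gaussian_estimates_def by blast
  have risk: "kl_risk n \<sigma>p \<sigma>f \<theta> p = (\<Sum>i<n. coord_risk n \<sigma>p \<sigma>f t d \<theta> i)" for \<theta>
    unfolding p using assms td by (intro kl_risk_eq_sum_coord_risk)
  show "ennreal (real s * w * (K / 2) *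
      (1 - (w / (1 - w) * (real s / real (n - s + 1)) * (1 + K)) powr \<tau>
        * exp ((\<tau> + \<tau>\<^sup>2) * \<mu>\<^sup>2 / (2 * \<sigma>p\<^sup>2)))) \<le> (SUP \<theta> \<in> sparse_vectors n s. kl_risk n \<sigma>p \<sigma>f \<theta> p)"
  proof (cases "SUP \<theta> \<in> sparse_vectors n s. kl_risk n \<sigma>p \<sigma>f \<theta> p")
    case (real M)
    have "(\<Sum>i<n. coord_risk n \<sigma>p \<sigma>f t d \<theta> i) \<le> ennreal M" if "\<theta> \<in> sparse_vectors n s" for \<theta>
      unfolding real(2)[symmetric] risk[symmetric] using that by (rule SUP_upper)
    then show ?thesis
      unfolding real(2) K_def using assms(1-8) td real(1)
      by (intro ennreal_leI kl_risk_lower) auto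
  next
    case top
    then show ?thesis
      by (simp only: top_greatest)
  qed
qed

section \<open>Asymptotics\<close>

text \<open>With \<open>x = ln (n / s)\<close> and \<open>l = sqrt (2 * x)\<close>, the null
  coordinates contribute \<open>2 * s\<close> and the signals \<open>s * (1 + l)\<^sup>2\<close>, up
  to the common factor. The sum is \<open>2 * x * s\<close> to leading order.\<close>

lemma gaussian_minimax_risk_asymp_upper:
  fixes \<sigma>p \<sigma>f \<epsilon> :: real and s :: "nat \<Rightarrow> nat"
  assumes "\<sigma>p > 0" "\<sigma>f > 0" and s: "\<And>n. s n > 0"
    and L: "filterlim (\<lambda>n. ln (real n / real (s n))) at_top sequentially"
    and "\<epsilon> > 0"
  shows "\<forall>\<^sub>F n in sequentially. gaussian_minimax_risk n (s n) \<sigma>p \<sigma>f \<le>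
    ennreal (\<sigma>p\<^sup>2 / \<sigma>f\<^sup>2 * real (s n) * ln (real n / real (s n)) * (1 + \<epsilon>))"
proof -
  have "((\<lambda>x::real. ((1 + sqrt (2 * x))\<^sup>2 + 2) / (2 * x)) \<longlongrightarrow> 1) at_top"
    by real_asymp (simp add: powr_half_sqrt)
  then have "\<forall>\<^sub>F x in at_top. ((1 + sqrt (2 * x))\<^sup>2 + 2) / (2 * x) < 1 + \<epsilon>"
    using \<open>\<epsilon> > 0\<close> by (intro order_tendstoD) auto
  then have "\<forall>\<^sub>F n in sequentially. ((1 + sqrt (2 * ln (real n / real (s n))))\<^sup>2 + 2) /
      (2 * ln (real n / real (s n))) < 1 + \<epsilon>"
    by (rule eventually_compose_filterlim[OF _ L])
  moreover have "\<forall>\<^sub>F n in sequentially. ln (real n / real (s n)) > 0"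
    using L by (rule filterlim_at_top_dense[THEN iffD1, rule_format])
  moreover have "\<forall>\<^sub>F n in sequentially. n > 0"
    by (rule eventually_gt_at_top)
  ultimately show ?thesis
  proof eventually_elim
    case (elim n)
    define x where "x = ln (real n / real (s n))"
    have x: "x > 0" "((1 + sqrt (2 * x))\<^sup>2 + 2) / (2 * x) < 1 + \<epsilon>"
      using elim by (simp_all add: x_def)
    have "exp (- x) = real (s n) / real n"
      using s[of n] elim by (simp add: x_def exp_minus)
    then have "real n * exp (- (sqrt (2 * x))\<^sup>2 / 2) = real (s n)"
      using elim x by simp
    then have "\<sigma>p\<^sup>2 / (2 * \<sigma>f\<^sup>2) * (real (s n) * (1 + sqrt (2 * x))\<^sup>2
        + 2 * real n * exp (- (sqrt (2 * x))\<^sup>2 / 2)) =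
        \<sigma>p\<^sup>2 / (2 * \<sigma>f\<^sup>2) * real (s n) * ((1 + sqrt (2 * x))\<^sup>2 + 2)"
      by (simp only: mult.assoc) (simp add: algebra_simps)
    also have "\<dots> \<le> \<sigma>p\<^sup>2 / (2 * \<sigma>f\<^sup>2) * real (s n) * ((1 + \<epsilon>) * (2 * x))"
      using x by (intro mult_left_mono) (simp_all add: pos_divide_less_eq less_imp_le)
    also have "\<dots> = \<sigma>p\<^sup>2 / \<sigma>f\<^sup>2 * real (s n) * x * (1 + \<epsilon>)"
      by simp
    finally show ?case
      using gaussian_minimax_risk_upper[of \<sigma>p \<sigma>f "sqrt (2 * x)" n "s n"] assms x
      unfolding x_def[symmetric] by (meson ennreal_leI order_trans real_sqrt_ge_zero less_imp_le
          mult_pos_pos zero_less_numeral)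
  qed
qed

text \<open>One \<open>\<epsilon>\<close> serves as \<open>\<tau>\<close>, as \<open>1 - w\<close>
  and as the gap of \<open>\<mu>\<^sup>2\<close> below the critical value. The three factors
  \<open>1 - \<epsilon>\<close> come from \<open>w\<close>, from \<open>\<mu>\<^sup>2\<close> and
  from \<open>1 - e\<close>.\<close>

lemma gaussian_minimax_risk_asymp_lower:
  fixes \<sigma>p \<sigma>f \<epsilon> :: real and s :: "nat \<Rightarrow> nat"
  assumes "\<sigma>p > 0" "\<sigma>f > 0" and s: "\<And>n. s n > 0"
    and L: "filterlim (\<lambda>n. ln (real n / real (s n))) at_top sequentially"
    and \<epsilon>: "0 < \<epsilon>" "\<epsilon> < 1"
  shows "\<forall>\<^sub>F n in sequentially.
    ennreal (\<sigma>p\<^sup>2 / \<sigma>f\<^sup>2 * real (s n) * ln (real n / real (s n)) * (1 - \<epsilon>) ^ 3) \<le>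
    gaussian_minimax_risk n (s n) \<sigma>p \<sigma>f"
proof -
  define C where "C = 2 * ((1 - \<epsilon>) / \<epsilon>)"
  define c where "c = 2 * (1 - \<epsilon>) * (\<sigma>p\<^sup>2 / \<sigma>f\<^sup>2)"
  \<comment> \<open>\<open>q x powr \<epsilon>\<close> will bound the error \<open>e\<close>. The
    \<open>2\<close> in \<open>C\<close> pays for replacing \<open>n - s + 1\<close> by
    \<open>n / 2\<close>, and \<open>c * x\<close> is \<open>K\<close>.\<close>
  define q where "q = (\<lambda>x. C * (1 + c * x) * exp (- (\<epsilon>\<^sup>2 * x)))"
  have pos: "C > 0" "c > 0" "\<epsilon>\<^sup>2 > 0"
    using assms by (simp_all add: C_def c_def)
  have "(q \<longlongrightarrow> 0) at_top"
    unfolding q_def using pos by real_asymp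
  moreover have "\<forall>\<^sub>F x in at_top. q x \<ge> 0"
    using eventually_ge_at_top[of 0] by eventually_elim (use pos in \<open>simp add: q_def\<close>)
  ultimately have "((\<lambda>x. q x powr \<epsilon>) \<longlongrightarrow> 0 powr \<epsilon>) at_top"
    using \<epsilon> by (intro tendsto_powr') auto
  then have "\<forall>\<^sub>F x in at_top. q x powr \<epsilon> < \<epsilon>"
    using \<epsilon> by (intro order_tendstoD) auto
  then have "\<forall>\<^sub>F n in sequentially. q (ln (real n / real (s n))) powr \<epsilon> < \<epsilon>"
    by (rule eventually_compose_filterlim[OF _ L])
  \<comment> \<open>This ensures \<open>s < n / 2\<close>.\<close>
  moreover have "\<forall>\<^sub>F n in sequentially. ln (real n / real (s n)) > ln 2"
    using L by (rule filterlim_at_top_dense[THEN iffD1, rule_format])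
  moreover have "\<forall>\<^sub>F n in sequentially. n > 0"
    by (rule eventually_gt_at_top)
  ultimately show ?thesis
  proof eventually_elim
    case (elim n)
    define x where "x = ln (real n / real (s n))"
    define \<mu> where "\<mu> = \<sigma>p * sqrt (2 * (1 - \<epsilon>) * x)"
    define K where "K = \<mu>\<^sup>2 / \<sigma>f\<^sup>2"
    define A where "A = (1 - \<epsilon>) / (1 - (1 - \<epsilon>)) * (real (s n) / real (n - s n + 1))"
    define e where "e = (A * (1 + K)) powr \<epsilon> * exp ((\<epsilon> + \<epsilon>\<^sup>2) * \<mu>\<^sup>2 / (2 * \<sigma>p\<^sup>2))"
    have x: "x > 0" "q x powr \<epsilon> < \<epsilon>"
      using elim less_trans[OF ln_gt_zero[of "2::real"]] by (simp_all add: x_def)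
    have "real n / real (s n) > 2"
      using elim s[of n] by (subst (asm) ln_less_cancel_iff) auto
    then have sn: "2 * real (s n) < real n"
      using s[of n] by (simp add: pos_less_divide_eq)
    have \<mu>: "\<mu>\<^sup>2 = \<sigma>p\<^sup>2 * (2 * (1 - \<epsilon>) * x)"
      using x \<epsilon> by (simp add: \<mu>_def power_mult_distrib)
    have K: "K = c * x"
      by (simp add: K_def c_def \<mu>)
    have A: "A \<ge> 0" "A \<le> C * exp (- x)"
    proof -
      show "A \<ge> 0"
        using \<epsilon> by (simp add: A_def)
      have "real (s n) / real (n - s n + 1) \<le> real (s n) / (real n / 2)"
        using sn elim by (intro divide_left_mono) (auto simp: of_nat_diff)
      also have "\<dots> = 2 * exp (- x)"
        using s[of n] elim by (simp add: x_def exp_minus)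
      finally have "(1 - \<epsilon>) / \<epsilon> * (real (s n) / real (n - s n + 1)) \<le> (1 - \<epsilon>) / \<epsilon> * (2 * exp (- x))"
        using \<epsilon> by (intro mult_left_mono) auto
      then show "A \<le> C * exp (- x)"
        by (simp add: A_def C_def algebra_simps)
    qed
    \<comment> \<open>The choice \<open>\<tau> = \<epsilon>\<close> makes the growth rate
      \<open>(1 - \<epsilon>) * (1 + \<epsilon>) = 1 - \<epsilon>\<^sup>2\<close>, strictly below
      the decay rate \<open>1\<close> of the prior odds.\<close>
    have "(\<epsilon> + \<epsilon>\<^sup>2) * \<mu>\<^sup>2 / (2 * \<sigma>p\<^sup>2) = ((1 - \<epsilon>\<^sup>2) * x) * \<epsilon>"
      using \<open>\<sigma>p > 0\<close> by (simp add: \<mu>) (simp add: power2_eq_square algebra_simps)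
    then have "e = (A * (1 + K) * exp ((1 - \<epsilon>\<^sup>2) * x)) powr \<epsilon>"
      using A K pos x by (simp add: e_def powr_mult exp_powr_real)
    also have "\<dots> \<le> q x powr \<epsilon>"
    proof (intro powr_mono2)
      have "A * (1 + K) * exp ((1 - \<epsilon>\<^sup>2) * x) \<le> C * exp (- x) * (1 + K) * exp ((1 - \<epsilon>\<^sup>2) * x)"
        using A K pos x by (intro mult_right_mono) auto
      also have "\<dots> = C * (1 + K) * (exp (- x) * exp ((1 - \<epsilon>\<^sup>2) * x))"
        by simp
      also have "exp (- x) * exp ((1 - \<epsilon>\<^sup>2) * x) = exp (- (\<epsilon>\<^sup>2 * x))"
        by (simp add: exp_add[symmetric] algebra_simps)
      finally show "A * (1 + K) * exp ((1 - \<epsilon>\<^sup>2) * x) \<le> q x"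
        by (simp add: q_def K)
    qed (use A K pos x \<epsilon> in auto)
    finally have e: "e \<le> \<epsilon>"
      using x by simp
    have main: "\<sigma>p\<^sup>2 / \<sigma>f\<^sup>2 * x * (1 - \<epsilon>) = K / 2"
      using \<open>\<sigma>f > 0\<close> by (simp add: K c_def field_simps)
    have "\<sigma>p\<^sup>2 / \<sigma>f\<^sup>2 * real (s n) * x * (1 - \<epsilon>) ^ 3 =
        real (s n) * (1 - \<epsilon>) * (K / 2) * (1 - \<epsilon>)"
      unfolding main[symmetric] by (simp add: power3_eq_cube)
    also have "\<dots> \<le> real (s n) * (1 - \<epsilon>) * (K / 2) * (1 - e)"
      using e K pos x \<epsilon> by (intro mult_left_mono) auto
    also have "ennreal \<dots> \<le> gaussian_minimax_risk n (s n) \<sigma>p \<sigma>f"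
      unfolding e_def A_def K_def using assms(1,2) \<epsilon> s[of n] sn
      by (intro gaussian_minimax_risk_lower) auto
    finally show ?case
      by (simp add: x_def ennreal_leI)
  qed
qed

theorem theorem1p3:
  fixes \<sigma>p \<sigma>f r :: real and s :: "nat \<Rightarrow> nat"
  assumes "\<sigma>p > 0" and "\<sigma>f > 0" and "r = \<sigma>f\<^sup>2 / \<sigma>p\<^sup>2"
    and "\<And>n. s n > 0"
    and "(\<lambda>n. real (s n) / real n) \<longlonglongrightarrow> 0"
  shows "\<exists>\<epsilon> :: nat \<Rightarrow> real. \<epsilon> \<longlonglongrightarrow> 0 \<and>
    (\<forall>\<^sub>F n in sequentially.
       gaussian_minimax_risk n (s n) \<sigma>p \<sigma>f =
         ennreal (inverse r * real (s n) * ln (real n / real (s n)) * (1 + \<epsilon> n)))"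
proof -
  let ?G = "\<lambda>n. gaussian_minimax_risk n (s n) \<sigma>p \<sigma>f"
  define X where "X = (\<lambda>n. inverse r * real (s n) * ln (real n / real (s n)))"
  have X: "X n = \<sigma>p\<^sup>2 / \<sigma>f\<^sup>2 * real (s n) * ln (real n / real (s n))" for n
    by (simp add: X_def assms(3))
  have "\<forall>\<^sub>F n in sequentially. real (s n) / real n > 0"
    using eventually_gt_at_top[of 0] by eventually_elim (use assms(4) in simp)
  then have "filterlim (\<lambda>n. inverse (real (s n) / real n)) at_top sequentially"
    using assms(5) by (intro filterlim_inverse_at_top)
  then have L: "filterlim (\<lambda>n. ln (real n / real (s n))) at_top sequentially"
    by (intro filterlim_compose[OF ln_at_top]) simp
  have Xpos: "\<forall>\<^sub>F n in sequentially. X n > 0"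
  proof -
    have "\<forall>\<^sub>F n in sequentially. ln (real n / real (s n)) > 0"
      using L by (rule filterlim_at_top_dense[THEN iffD1, rule_format])
    then show ?thesis
      by eventually_elim (use assms in \<open>simp add: X\<close>)
  qed
  note upper = gaussian_minimax_risk_asymp_upper[OF assms(1,2,4) L, folded X]
  note lower = gaussian_minimax_risk_asymp_lower[OF assms(1,2,4) L, folded X]
  \<comment> \<open>Needed because \<open>enn2real\<close> maps \<open>\<top>\<close> to
    \<open>0\<close>; the upper bound with \<open>\<epsilon> = 1\<close> suffices.\<close>
  have finite: "\<forall>\<^sub>F n in sequentially. ?G n = ennreal (enn2real (?G n))"
    using upper[OF zero_less_one]
  proof eventually_elim
    case (elim n)
    then have "?G n < \<top>"
      using ennreal_less_top le_less_trans by blast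
    then show ?case
      by simp
  qed
  \<comment> \<open>The relative error is solved for from the claimed identity, so only its
    convergence remains.\<close>
  define \<epsilon> where "\<epsilon> = (\<lambda>n. enn2real (?G n) / X n - 1)"
  have "\<epsilon> \<longlonglongrightarrow> 0"
  proof (rule tendstoI)
    fix \<delta> :: real assume "\<delta> > 0"
    \<comment> \<open>Small enough that Bernoulli's inequality puts the cube in the lower bound
      above \<open>1 - \<delta>\<close>, and below one as the lower bound requires.\<close>
    define \<eta> where "\<eta> = min (\<delta> / 4) (1 / 2)"
    have \<eta>: "0 < \<eta>" "\<eta> < 1" "4 * \<eta> \<le> \<delta>"
      using \<open>\<delta> > 0\<close> by (auto simp: \<eta>_def)
    have "1 - 3 * \<eta> \<le> (1 - \<eta>) ^ 3"
      using \<eta> Bernoulli_inequality[of "- \<eta>" 3] by simp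
    then have cube: "1 - \<delta> < (1 - \<eta>) ^ 3"
      using \<eta> by linarith
    have "\<forall>\<^sub>F n in sequentially. \<bar>\<epsilon> n\<bar> < \<delta>"
      using upper[OF \<eta>(1)] lower[OF \<eta>(1,2)] finite Xpos
    proof eventually_elim
      case (elim n)
      define g where "g = enn2real (?G n)"
      have g: "?G n = ennreal g" "g \<ge> 0"
        using elim by (simp_all add: g_def)
      have "g \<le> X n * (1 + \<eta>)" "X n * (1 - \<eta>) ^ 3 \<le> g"
        using elim \<eta> g(2) unfolding g(1) by (simp_all add: ennreal_le_iff)
      then have "g / X n \<le> 1 + \<eta>" "(1 - \<eta>) ^ 3 \<le> g / X n"
        using elim by (simp_all add: pos_divide_le_eq pos_le_divide_eq mult.commute)
      then show "\<bar>\<epsilon> n\<bar> < \<delta>"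
        using cube \<eta> unfolding \<epsilon>_def g_def[symmetric] by linarith
    qed
    then show "\<forall>\<^sub>F n in sequentially. dist (\<epsilon> n) 0 < \<delta>"
      by simp
  qed
  moreover have "\<forall>\<^sub>F n in sequentially. ?G n = ennreal (X n * (1 + \<epsilon> n))"
    using finite Xpos by eventually_elim (simp add: \<epsilon>_def)
  ultimately show ?thesis
    unfolding X_def by blast
qed

end
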